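(* Let $\mathbb{P}$ be the unique Gibbs measure on $\Omega=\mathcal{A}^{\mathbb{Z}}$ with interaction $U\in\mathcal{U}$, let $\alpha = p(U)-\frac{p(2U)}{2}$ (which is strictly positive) and $k^*(n)=\frac{\ln n}{\alpha}$. Let $N(\sigma,n,k)$ be the number of shift-matches of length $k$ up to $n$, and let $\mathbb{E}$ denote expectation with respect to $\mathbb{P}$. Let $\{k(n)\}_{n\in\mathbb{N}}$ be a sequence of integers. Then: 1. If $k^*(n)-k(n)\to\infty$ as $n\to\infty$, then $\lim_{n\to\infty}\mathbb{E}(N(\sigma,n,k(n)))=\infty$. 2. If $k(n)-k^*(n)\to\infty$ as $n\to\infty$, then $\lim_{n\to\infty}\mathbb{E}(N(\sigma,n,k(n)))=0$. 3. If $k(n)-k^*(n)$ is a bounded sequence, then $$0<\liminf_{n\to\infty}\mathbb{E}(N(\sigma,n,k(n)))\le\limsup_{n\to\infty}\mathbb{E}(N(\sigma,n,k(n)))<\infty.$$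
   Context: $\mathcal{A}$ is a finite set with at least two elements; $\Omega=\mathcal{A}^{\mathbb{Z}}$ with the product topology and product sigma-field; $\mathcal{S}$ is the set of (nonempty) finite subsets of $\mathbb{Z}$; for $V\subseteq\mathbb{Z}$, $\sigma_V$ is the restriction of $\sigma\in\Omega$ to $V$, $\Omega_V=\mathcal{A}^V$, and $\mathcal{F}_V$ is the sigma-field generated by $\{\sigma(i):i\in V\}$. The shift is $(\tau_i\sigma)(j)=\sigma(i+j)$. $\operatorname{diam}(A)=\max\{|i-j|:i,j\in A\}$. $C_k=\{1,\dots,k\}$. Interactions: $\mathcal{U}$ is the set of maps $U:\mathcal{S}\times\Omega\to\mathbb{R}$ such that (i) $\sigma\mapsto U(A,\sigma)$ is $\mathcal{F}_A$-measurable for all $A\in\mathcal{S}$; (ii) $U(A+i,\tau_{-i}\sigma)=U(A,\sigma)$ for all $A\in\mathcal{S}$, $i\in\mathbb{Z}$, $\sigma\in\Omega$; (iii) there is $\gamma>0$ with $\sum_{A\ni 0}e^{\gamma\operatorname{diam}(A)}\sup_{\sigma\in\Omega}|U(A,\sigma)|<\infty$. For real $q$, $(qU)(A,\sigma)=q\,U(A,\sigma)$. Gibbs measures: for $\Lambda\in\mathcal{S}$, $\zeta\in\Omega$, put $H_\Lambda^\zeta(\sigma)=\sum_{A\cap\Lambda\ne\varnothing}U(A,\sigma_\Lambda\zeta_{\Lambda^c})$, where $\sigma_\Lambda\zeta_{\Lambda^c}$ equals $\sigma$ on $\Lambda$ and $\zeta$ off $\Lambda$. A probability measure $\mathbb{P}$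 on $\Omega$ is a Gibbs measure with interaction $U$ if for all $\Lambda\in\mathcal{S}$ the conditional distribution of $\sigma_\Lambda$ given $\sigma_{\Lambda^c}=\zeta_{\Lambda^c}$ is, for $\mathbb{P}$-a.e. $\zeta$, given by the weights $e^{-H_\Lambda^\zeta(\sigma)}/\sum_{\sigma'_\Lambda\in\Omega_\Lambda}e^{-H_\Lambda^\zeta(\sigma')}$. For $U\in\mathcal{U}$ there is exactly one Gibbs measure with interaction $U$. Pressure: $p(U)=\lim_{n\to\infty}\frac1n\log\sum_{\sigma_{C_n}\in\Omega_{C_n}}\exp\bigl(-\sum_{A\subseteq C_n}U(A,\sigma)\bigr)$. Number of shift-matches: for integers $1\le k\le n$, $N(\sigma,n,k)=\frac12\sum_{i=0}^{n-k}\sum_{j=0,\,j\ne i}^{n-k}\mathbb{1}\{(\tau_i\sigma)_{C_k}=(\tau_j\sigma)_{C_k}\}$, i.e. the number of pairs $0\le i<j\le n-k$ with $\sigma(i+l)=\sigma(j+l)$ for all $l=1,\dots,k$. Sequences $k(n)$ are understood to satisfy $1\le k(n)\le n$ for all sufficiently large $n$, so that $N(\sigma,n,k(n))$ is defined. *)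

theory Defs
  imports "HOL-Probability.Probability"
begin

text \<open>The alphabet is a type \<open>'a\<close> of class \<open>finite\<close>; configurations are functions \<open>int \<Rightarrow> 'a\<close>.
  Elements of \<open>\<Omega>\<^sub>V\<close> are represented by extensional functions, i.e. \<open>\<Omega>\<^sub>V\<close> is \<open>V \<rightarrow>\<^sub>E UNIV\<close>.\<close>

definition config_space :: "(int \<Rightarrow> 'a) measure" where
  "config_space = (\<Pi>\<^sub>M i\<in>UNIV. count_space UNIV)"

definition sub_field :: "int set \<Rightarrow> (int \<Rightarrow> 'a) measure" where
  "sub_field V = sigma UNIV {{\<sigma>. \<sigma> i \<in> B} | i B. i \<in> V}"

definition fin_sets :: "int set set" where
  "fin_sets = {A. finite A \<and> A \<noteq> {}}"

definition shift :: "int \<Rightarrow> (int \<Rightarrow> 'a) \<Rightarrow> int \<Rightarrow> 'a" where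
  "shift i \<sigma> = (\<lambda>j. \<sigma> (i + j))"

abbreviation block :: "int \<Rightarrow> int set" where
  "block k \<equiv> {1..k}"

definition diam :: "int set \<Rightarrow> int" where
  "diam A = Max {\<bar>i - j\<bar> | i j. i \<in> A \<and> j \<in> A}"

type_synonym 'a interaction = "int set \<Rightarrow> (int \<Rightarrow> 'a) \<Rightarrow> real"

text \<open>An interaction is only ever evaluated at sets in \<^const>\<open>fin_sets\<close>; its values at other sets are
  irrelevant. The supremum below is over a bounded set: as \<open>A\<close> and the alphabet are finite, the
  measurability condition leaves \<open>U A\<close> only finitely many values.\<close>

definition interactions :: "('a::finite) interaction set" where
  "interactions = {U.
     (\<forall>A\<in>fin_sets. U A \<in> borel_measurable (sub_field A)) \<and>
     (\<forall>A\<in>fin_sets. \<forall>i \<sigma>. U ((\<lambda>j. j + i) ` A) (shift (- i) \<sigma>) = U A \<sigma>) \<and>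
     (\<exists>\<gamma>>0. (\<lambda>A. exp (\<gamma> * real_of_int (diam A)) * (SUP \<sigma>. \<bar>U A \<sigma>\<bar>))
               summable_on {A\<in>fin_sets. 0 \<in> A})}"

definition scale_interaction :: "real \<Rightarrow> 'a interaction \<Rightarrow> 'a interaction" where
  "scale_interaction q U = (\<lambda>A \<sigma>. q * U A \<sigma>)"

text \<open>\<open>override_on \<zeta> \<sigma> \<Lambda>\<close> agrees with \<open>\<sigma>\<close> on \<open>\<Lambda>\<close> and with \<open>\<zeta>\<close> off \<open>\<Lambda>\<close>.\<close>

definition hamiltonian ::
    "'a interaction \<Rightarrow> int set \<Rightarrow> (int \<Rightarrow> 'a) \<Rightarrow> (int \<Rightarrow> 'a) \<Rightarrow> real" where
  "hamiltonian U \<Lambda> \<zeta> \<sigma> =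
     (\<Sum>\<^sub>\<infinity>A\<in>{A\<in>fin_sets. A \<inter> \<Lambda> \<noteq> {}}. U A (override_on \<zeta> \<sigma> \<Lambda>))"

text \<open>The conditional probability that the configuration equals \<open>\<eta>\<close> on \<open>\<Lambda>\<close>, given the
  configuration off \<open>\<Lambda>\<close>, is a conditional expectation given \<open>sub_field (- \<Lambda>)\<close>.\<close>

definition gibbs_measure :: "('a::finite) interaction \<Rightarrow> (int \<Rightarrow> 'a) measure \<Rightarrow> bool" where
  "gibbs_measure U P \<longleftrightarrow>
     prob_space P \<and> sets P = sets config_space \<and>
     (\<forall>\<Lambda>\<in>fin_sets. AE \<zeta> in P. \<forall>\<eta>\<in>\<Lambda> \<rightarrow>\<^sub>E UNIV.
        real_cond_exp P (sub_field (- \<Lambda>)) (indicator {\<sigma>. restrict \<sigma> \<Lambda> = \<eta>}) \<zeta> =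
        exp (- hamiltonian U \<Lambda> \<zeta> \<eta>) /
        (\<Sum>\<eta>'\<in>\<Lambda> \<rightarrow>\<^sub>E UNIV. exp (- hamiltonian U \<Lambda> \<zeta> \<eta>')))"

text \<open>\<open>U A \<sigma>\<close> depends only on \<open>\<sigma>\<close> on \<open>A\<close>, so it may be evaluated at an extensional function on
  a block containing \<open>A\<close>.\<close>

definition pressure :: "('a::finite) interaction \<Rightarrow> real" where
  "pressure U = lim (\<lambda>n. 1 / real n * ln
     (\<Sum>\<sigma>\<in>block (int n) \<rightarrow>\<^sub>E UNIV. exp (- (\<Sum>A\<in>{A\<in>fin_sets. A \<subseteq> block (int n)}. U A \<sigma>))))"

definition alpha :: "('a::finite) interaction \<Rightarrow> real" where
  "alpha U = pressure U - pressure (scale_interaction 2 U) / 2"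

definition kstar :: "('a::finite) interaction \<Rightarrow> nat \<Rightarrow> real" where
  "kstar U n = ln (real n) / alpha U"

definition shift_matches :: "(int \<Rightarrow> 'a) \<Rightarrow> int \<Rightarrow> int \<Rightarrow> real" where
  "shift_matches \<sigma> n k = 1 / 2 * (\<Sum>i\<in>{0..n - k}. \<Sum>j\<in>{0..n - k} - {i}.
     of_bool (restrict (shift i \<sigma>) (block k) = restrict (shift j \<sigma>) (block k)))"

lemma space_sub_field [simp]: "space (sub_field V) = UNIV"
  by (simp add: sub_field_def)

lemma subalgebra_sub_field: "subalgebra config_space (sub_field V)"
proof -
  have "{{\<sigma>. \<sigma> i \<in> B} | i B. i \<in> V} \<subseteq> sets (config_space :: (int \<Rightarrow> 'a) measure)"
  proof clarify
    fix i and B :: "'a set"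
    have "(\<lambda>\<sigma>. \<sigma> i) \<in> measurable (config_space :: (int \<Rightarrow> 'a) measure) (count_space UNIV)"
      unfolding config_space_def by measurable
    from measurable_sets[OF this, of B]
    show "{\<sigma>. \<sigma> i \<in> B} \<in> sets (config_space :: (int \<Rightarrow> 'a) measure)"
      by (simp add: vimage_def config_space_def space_PiM)
  qed
  from sets.sigma_sets_subset[OF this]
  have "sets (sub_field V) \<subseteq> sets (config_space :: (int \<Rightarrow> 'a) measure)"
    by (simp add: sub_field_def config_space_def space_PiM)
  then show ?thesis
    by (simp add: subalgebra_def) (simp add: config_space_def space_PiM)
qed

end

theory Submission imports Defs begin

text \<open>
  Exponential summability bounds, uniformly in the site, the total strength \<open>D\<close> of the interaction
  across any bond of \<open>\<int>\<close>. Hence partition sums of adjacent blocks multiply up to a constant, so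
  \<open>ln Z\<^sub>k(qU) = k p(qU) + O(1)\<close>, and given anything outside a block the Gibbs probability of
  seeing \<open>\<eta>\<close> in that block is \<open>e\<^bsup>-W(\<eta>)\<^esup>/Z\<^sub>k(U)\<close> up to a constant factor,
  where \<open>W\<close> is the energy inside the block. Two disjoint windows of length
  \<open>k\<close> therefore match with probability comparable to \<open>Z\<^sub>k(2U)/Z\<^sub>k(U)\<^sup>2\<close>, that is, to
  \<open>e\<^bsup>-2\<alpha>k\<^esup>\<close>.

  If the two windows overlap with offset \<open>m < k\<close>, a match forces equal words on two adjacent blocks of length
  \<open>m\<close> and then determines the next \<open>k - m\<close> letters; since a single word of length \<open>k - m\<close> has weight
  at most \<open>(Z(2U)/Z(U)\<^sup>2)\<^bsup>1/2\<^esup>\<close>, the probability is \<open>O(e\<^bsup>-\<alpha>(k+m)\<^esup>)\<close>, summable in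
  \<open>m\<close>. With \<open>t = n e\<^bsup>-\<alpha>k\<^esup>\<close> the expected number of matches is thus at most a constant times
  \<open>t\<^sup>2 + t\<close>, and at least a constant times \<open>t\<^sup>2\<close> as soon as \<open>6k \<le> n\<close>.

  Positivity of \<open>\<alpha>\<close>: changing one letter changes the energy by a bounded amount, so every word of
  length \<open>k\<close> carries an exponentially small share of \<open>Z\<^sub>k(U)\<close>.
\<close>

section \<open>Bounds on the interaction across a bond and at a site\<close>

text \<open>The bond labelled \<open>b\<close> is the one between the sites \<open>b\<close> and
  \<open>b + 1\<close>.\<close>

definition crossing :: "int \<Rightarrow> int set set" where
  "crossing b = {A\<in>fin_sets. (\<exists>x\<in>A. x \<le> b) \<and> (\<exists>y\<in>A. b < y)}"

text \<open>Collects what the later arguments use of an interaction; the decay rate \<gamma> is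
  absorbed into \<open>S\<close> and \<open>D\<close>. The constant \<open>S\<close> controls the
  effect of changing one letter, \<open>D\<close> the coupling between adjacent blocks. Bounds for
  finite families suffice, since they also yield absolute convergence of the Hamiltonian.\<close>

locale bounded_interaction =
  fixes U :: "('a::finite) interaction" and N :: "int set \<Rightarrow> real" and S D :: real
  assumes local: "\<lbrakk>A \<in> fin_sets; \<And>i. i \<in> A \<Longrightarrow> \<sigma> i = \<sigma>' i\<rbrakk> \<Longrightarrow> U A \<sigma> = U A \<sigma>'"
    and translate: "A \<in> fin_sets \<Longrightarrow> U ((\<lambda>j. j + i) ` A) (shift (- i) \<sigma>) = U A \<sigma>"
    and abs_le: "A \<in> fin_sets \<Longrightarrow> \<bar>U A \<sigma>\<bar> \<le> N A"
    and site: "\<lbrakk>finite F; F \<subseteq> {A\<in>fin_sets. x \<in> A}\<rbrakk> \<Longrightarrow> sum N F \<le> S"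
    and cross: "\<lbrakk>finite F; F \<subseteq> crossing b\<rbrakk> \<Longrightarrow> sum N F \<le> D"

section \<open>Locality of measurable functions, and diameters\<close>

text \<open>No generator of the sigma-field separates two configurations that agree on
  \<open>A\<close>; by induction no set of the sigma-field does, and the level set of
  \<open>f\<close> at \<open>f \<sigma>\<close> is one of them.\<close>

lemma sub_field_measurable_local:
  fixes f :: "(int \<Rightarrow> 'a) \<Rightarrow> real"
  assumes f: "f \<in> borel_measurable (sub_field A)" and eq: "\<And>i. i \<in> A \<Longrightarrow> \<sigma> i = \<sigma>' i"
  shows "f \<sigma> = f \<sigma>'"
proof -
  have "f -` {f \<sigma>} \<inter> space (sub_field A) \<in> sets (sub_field A)"
    using f by (rule measurable_sets) simp
  then have "f -` {f \<sigma>} \<in> sigma_sets UNIV {{\<sigma>. \<sigma> i \<in> B} | i B. i \<in> A}"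
    by (simp add: sub_field_def)
  moreover have "\<sigma> \<in> X \<longleftrightarrow> \<sigma>' \<in> X"
    if "X \<in> sigma_sets UNIV {{\<sigma>. \<sigma> i \<in> B} | i B. i \<in> A}" for X
    using that by (induction rule: sigma_sets.induct) (auto simp: eq)
  ultimately have "\<sigma> \<in> f -` {f \<sigma>} \<longleftrightarrow> \<sigma>' \<in> f -` {f \<sigma>}" by blast
  then show ?thesis by simp
qed

lemma finite_diam_set: "finite A \<Longrightarrow> finite {\<bar>i - j\<bar> | i j. i \<in> A \<and> j \<in> (A :: int set)}"
  by (rule finite_subset[of _ "(\<lambda>(i,j). \<bar>i - j\<bar>) ` (A \<times> A)"]) auto

lemma abs_diff_le_diam:
  assumes "A \<in> fin_sets" "x \<in> A" "y \<in> A"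
  shows "\<bar>x - y\<bar> \<le> diam A"
  unfolding diam_def using assms by (intro Max_ge finite_diam_set) (auto simp: fin_sets_def)

lemma diam_nonneg: "A \<in> fin_sets \<Longrightarrow> 0 \<le> diam A"
  using abs_diff_le_diam[of A] by (fastforce simp: fin_sets_def)

lemma diam_translate: "diam ((\<lambda>j. j + i) ` A) = diam A"
proof -
  have "{\<bar>x - y\<bar> | x y. x \<in> (\<lambda>j. j + i) ` A \<and> y \<in> (\<lambda>j. j + i) ` A}
      = {\<bar>x - y\<bar> | x y. x \<in> A \<and> y \<in> A}"
  proof (intro set_eqI iffI)
    fix d assume "d \<in> {\<bar>x - y\<bar> | x y. x \<in> A \<and> y \<in> A}"
    then obtain x y where "d = \<bar>(x + i) - (y + i)\<bar>" "x \<in> A" "y \<in> A" by auto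
    then show "d \<in> {\<bar>x - y\<bar> | x y. x \<in> (\<lambda>j. j + i) ` A \<and> y \<in> (\<lambda>j. j + i) ` A}" by blast
  qed (auto, blast)
  then show ?thesis by (simp add: diam_def)
qed

lemma translate_fin_sets [simp]: "(\<lambda>j. j + i) ` A \<in> fin_sets \<longleftrightarrow> A \<in> fin_sets"
  by (auto simp: fin_sets_def dest: finite_imageD)

text \<open>On either side of \<open>b\<close> the distances to \<open>b\<close> are distinct, so
  each half of the sum is dominated by a geometric series. The bound serves twice: for the leftmost
  sites of sets crossing a bond, and for the offsets of overlapping windows.\<close>

lemma sum_exp_abs_le:
  fixes b :: int and g :: real
  assumes "finite X" "0 < g"
  shows "(\<Sum>x\<in>X. exp (- g * \<bar>x - b\<bar>)) \<le> 2 / (1 - exp (- g))"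
proof -
  have *: "(\<Sum>x\<in>Y. exp (- g * \<bar>x - b\<bar>)) \<le> 1 / (1 - exp (- g))"
    if "inj_on (\<lambda>x. nat \<bar>x - b\<bar>) Y" "finite Y" for Y
  proof -
    have "(\<Sum>x\<in>Y. exp (- g * \<bar>x - b\<bar>)) = (\<Sum>x\<in>Y. exp (- g) ^ nat \<bar>x - b\<bar>)"
      by (intro sum.cong refl) (simp add: exp_of_nat_mult[symmetric] mult.commute)
    also have "\<dots> = (\<Sum>k\<in>(\<lambda>x. nat \<bar>x - b\<bar>) ` Y. exp (- g) ^ k)"
      using that by (simp add: sum.reindex)
    also have "\<dots> \<le> (\<Sum>k. exp (- g) ^ k)"
      using that assms by (intro sum_le_suminf summable_geometric) auto
    also have "\<dots> = 1 / (1 - exp (- g))"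
      using assms by (intro suminf_geometric) auto
    finally show ?thesis .
  qed
  have "(\<Sum>x\<in>X. exp (- g * \<bar>x - b\<bar>))
      = (\<Sum>x\<in>X \<inter> {b..}. exp (- g * \<bar>x - b\<bar>)) + (\<Sum>x\<in>X - {b..}. exp (- g * \<bar>x - b\<bar>))"
    using assms by (intro sum.Int_Diff)
  also have "\<dots> \<le> 1 / (1 - exp (- g)) + 1 / (1 - exp (- g))"
    using assms by (intro add_mono * inj_onI) auto
  finally show ?thesis by simp
qed

text \<open>The exponential weight pays for the distance to the bond: a set crossing
  \<open>b\<close> with leftmost site \<open>x\<close> has diameter at least the distance from
  \<open>x\<close> to \<open>b\<close>, so all such sets together contribute at most
  \<open>S * exp (- g * \<bar>x - b\<bar>)\<close>, which is summable over \<open>x\<close>.\<close>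

lemma bounded_interaction_exists:
  fixes U :: "('a::finite) interaction"
  assumes U: "U \<in> interactions"
  shows "\<exists>N S D. bounded_interaction U N S D"
proof -
  define N where "N A = (SUP \<sigma>. \<bar>U A \<sigma>\<bar>)" for A
  from U obtain g where g: "0 < g"
    and summ: "(\<lambda>A. exp (g * real_of_int (diam A)) * N A) summable_on {A\<in>fin_sets. 0 \<in> A}"
    and trans: "\<And>A i \<sigma>. A \<in> fin_sets \<Longrightarrow> U ((\<lambda>j. j + i) ` A) (shift (- i) \<sigma>) = U A \<sigma>"
    and meas: "\<And>A. A \<in> fin_sets \<Longrightarrow> U A \<in> borel_measurable (sub_field A)"
    unfolding interactions_def N_def by blast
  have loc: "U A \<sigma> = U A \<sigma>'" if "A \<in> fin_sets" "\<And>i. i \<in> A \<Longrightarrow> \<sigma> i = \<sigma>' i" for A \<sigma> \<sigma>'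
    using sub_field_measurable_local[OF meas] that by blast
  \<comment> \<open>Locality leaves finitely many values, so the real supremum defining
    \<open>N A\<close> is a genuine upper bound.\<close>
  have "finite (range (\<lambda>\<sigma>. \<bar>U A \<sigma>\<bar>))" if A: "A \<in> fin_sets" for A
  proof -
    have "range (\<lambda>\<sigma>. \<bar>U A \<sigma>\<bar>) \<subseteq> (\<lambda>\<sigma>. \<bar>U A \<sigma>\<bar>) ` (A \<rightarrow>\<^sub>E UNIV)"
    proof clarify
      fix \<sigma>
      have "U A \<sigma> = U A (restrict \<sigma> A)" using A by (intro loc) auto
      then show "\<bar>U A \<sigma>\<bar> \<in> (\<lambda>\<sigma>. \<bar>U A \<sigma>\<bar>) ` (A \<rightarrow>\<^sub>E UNIV)" by auto
    qed
    moreover have "finite (A \<rightarrow>\<^sub>E (UNIV :: 'a set))"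
      using A by (intro finite_PiE) (auto simp: fin_sets_def)
    ultimately show ?thesis using finite_surj by blast
  qed
  then have abs_le: "\<bar>U A \<sigma>\<bar> \<le> N A" if "A \<in> fin_sets" for A \<sigma>
    unfolding N_def using that by (intro cSUP_upper bdd_above_finite) auto
  have N0: "0 \<le> N A" if "A \<in> fin_sets" for A
    using abs_le[OF that, of undefined] by linarith
  have N_trans: "N ((\<lambda>j. j + i) ` A) = N A" if "A \<in> fin_sets" for A i
  proof -
    have "surj (shift (- i) :: (int \<Rightarrow> 'a) \<Rightarrow> _)"
      by (rule surjI[of _ "shift i"]) (simp add: shift_def)
    then have "range (\<lambda>\<sigma>. \<bar>U ((\<lambda>j. j + i) ` A) \<sigma>\<bar>)
        = range (\<lambda>\<sigma>. \<bar>U ((\<lambda>j. j + i) ` A) (shift (- i) \<sigma>)\<bar>)"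
      by (simp add: image_image[symmetric, of "\<lambda>\<sigma>. \<bar>U ((\<lambda>j. j + i) ` A) \<sigma>\<bar>" "shift (- i)"])
    then show ?thesis using trans[OF that] by (simp add: N_def)
  qed
  define S where "S = (\<Sum>\<^sub>\<infinity>A\<in>{A\<in>fin_sets. 0 \<in> A}. exp (g * real_of_int (diam A)) * N A)"
  have weighted_site: "(\<Sum>A\<in>F. exp (g * real_of_int (diam A)) * N A) \<le> S"
    if F: "finite F" "F \<subseteq> {A\<in>fin_sets. x \<in> A}" for F x
  proof -
    \<comment> \<open>Translating by \<open>- x\<close> moves the family to sets through the origin,
      where summability is assumed.\<close>
    let ?t = "\<lambda>A. (\<lambda>j. j + (- x)) ` A"
    have "inj_on ?t F"
      by (intro inj_onI) (metis (no_types, lifting) add_right_cancel inj_image_eq_iff injI)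
    then have "(\<Sum>A\<in>?t ` F. exp (g * real_of_int (diam A)) * N A)
        = (\<Sum>A\<in>F. exp (g * real_of_int (diam (?t A))) * N (?t A))"
      by (simp add: sum.reindex)
    also have "\<dots> = (\<Sum>A\<in>F. exp (g * real_of_int (diam A)) * N A)"
    proof (intro sum.cong refl)
      fix A assume "A \<in> F"
      then have "A \<in> fin_sets" using F by auto
      from N_trans[OF this, of "- x"] diam_translate[of "- x" A]
      show "exp (g * real_of_int (diam (?t A))) * N (?t A)
          = exp (g * real_of_int (diam A)) * N A" by simp
    qed
    finally have "(\<Sum>A\<in>F. exp (g * real_of_int (diam A)) * N A)
        = (\<Sum>A\<in>?t ` F. exp (g * real_of_int (diam A)) * N A)" ..
    also have "\<dots> \<le> S"
      unfolding S_def
    proof (rule finite_sum_le_infsum[OF summ])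
      show "finite (?t ` F)" using F by simp
      show "?t ` F \<subseteq> {A \<in> fin_sets. 0 \<in> A}"
        using F by (force simp del: add_uminus_conv_diff)
    qed (auto simp: N0)
    finally show ?thesis .
  qed
  have "bounded_interaction U N S (S * (2 / (1 - exp (- g))))"
  proof
    show "sum N F \<le> S" if F: "finite F" "F \<subseteq> {A\<in>fin_sets. x \<in> A}" for F x
    proof -
      have "sum N F \<le> (\<Sum>A\<in>F. exp (g * real_of_int (diam A)) * N A)"
      proof (rule sum_mono)
        fix A assume "A \<in> F"
        then have "A \<in> fin_sets" using F by auto
        then show "N A \<le> exp (g * real_of_int (diam A)) * N A"
          using N0[of A] diam_nonneg[of A] g by (simp add: mult_le_cancel_right1)
      qed
      also have "\<dots> \<le> S" by (rule weighted_site[OF F])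
      finally show ?thesis .
    qed
    show "sum N F \<le> S * (2 / (1 - exp (- g)))" if F: "finite F" "F \<subseteq> crossing b" for F b
    proof -
      \<comment> \<open>The family is grouped by the leftmost site of its members.\<close>
      have "sum N F = (\<Sum>x\<in>Min ` F. \<Sum>A\<in>{A\<in>F. Min A = x}. N A)"
        using F by (intro sum.image_gen)
      also have "\<dots> \<le> (\<Sum>x\<in>Min ` F. S * exp (- g * \<bar>x - b\<bar>))"
      proof (rule sum_mono)
        fix x assume "x \<in> Min ` F"
        have "(\<Sum>A\<in>{A\<in>F. Min A = x}. N A)
            \<le> (\<Sum>A\<in>{A\<in>F. Min A = x}. exp (- g * \<bar>x - b\<bar>) * (exp (g * real_of_int (diam A)) * N A))"
        proof (rule sum_mono)
          fix A assume "A \<in> {A\<in>F. Min A = x}"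
          then have A: "A \<in> fin_sets" "finite A" "A \<noteq> {}" "A \<in> crossing b" "Min A = x"
            using F by (auto simp: crossing_def fin_sets_def)
          then obtain y z where yz: "y \<in> A" "y > b" "z \<in> A" "z \<le> b" by (auto simp: crossing_def)
          have x: "x \<in> A" using A Min_in by blast
          have "x \<le> z" using A yz by auto
          then have "\<bar>x - b\<bar> \<le> \<bar>x - y\<bar>" using yz by linarith
          also have "\<dots> \<le> diam A" using A x yz by (intro abs_diff_le_diam)
          finally have "g * real_of_int \<bar>x - b\<bar> \<le> g * real_of_int (diam A)"
            using g by (intro mult_left_mono) (auto simp only: of_int_le_iff)
          then have "1 \<le> exp (- g * \<bar>x - b\<bar>) * exp (g * real_of_int (diam A))"
            by (simp add: mult_exp_exp)
          then show "N A \<le> exp (- g * \<bar>x - b\<bar>) * (exp (g * real_of_int (diam A)) * N A)"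
            using mult_right_mono[OF _ N0[OF A(1)]] by (metis mult.assoc mult_1)
        qed
        also have "\<dots> = exp (- g * \<bar>x - b\<bar>) * (\<Sum>A\<in>{A\<in>F. Min A = x}. exp (g * real_of_int (diam A)) * N A)"
          by (simp add: sum_distrib_left)
        also have "\<dots> \<le> exp (- g * \<bar>x - b\<bar>) * S"
        proof (intro mult_left_mono weighted_site)
          show "{A \<in> F. Min A = x} \<subseteq> {A \<in> fin_sets. x \<in> A}"
            using F Min_in by (auto simp: crossing_def fin_sets_def)
        qed (use F in auto)
        finally show "(\<Sum>A\<in>{A\<in>F. Min A = x}. N A) \<le> S * exp (- g * \<bar>x - b\<bar>)"
          by (simp add: mult.commute)
      qed
      also have "\<dots> = S * (\<Sum>x\<in>Min ` F. exp (- g * \<bar>x - b\<bar>))"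
        by (simp add: sum_distrib_left)
      \<comment> \<open>The empty family in \<open>weighted_site\<close> supplies
        \<open>0 \<le> S\<close>.\<close>
      also have "\<dots> \<le> S * (2 / (1 - exp (- g)))"
        using weighted_site[of "{}"] F g by (intro mult_left_mono sum_exp_abs_le) auto
      finally show ?thesis .
    qed
  qed (fact loc trans abs_le)+
  then show ?thesis by blast
qed

section \<open>Energies, partition sums and the pressure\<close>

text \<open>The Hamiltonian with free boundary condition: only sets lying inside \<open>V\<close>
  interact.\<close>

definition energy :: "'a interaction \<Rightarrow> int set \<Rightarrow> (int \<Rightarrow> 'a) \<Rightarrow> real" where
  "energy U V \<eta> = (\<Sum>A\<in>{A\<in>fin_sets. A \<subseteq> V}. U A \<eta>)"

text \<open>The factor \<open>q\<close> plays the role of an inverse temperature, so the values 1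
  and 2 give the partition functions of \<open>U\<close> and \<open>2U\<close> without rescaling the
  interaction.\<close>

definition partition_sum :: "('a::finite) interaction \<Rightarrow> real \<Rightarrow> int set \<Rightarrow> real" where
  "partition_sum U q V = (\<Sum>\<eta>\<in>V \<rightarrow>\<^sub>E UNIV. exp (- q * energy U V \<eta>))"

lemma finite_configs: "finite V \<Longrightarrow> finite (V \<rightarrow>\<^sub>E (UNIV :: 'a::finite set))"
  by (simp add: finite_PiE)

lemma finite_fin_subsets: "finite V \<Longrightarrow> finite {A\<in>fin_sets. A \<subseteq> V}"
  by (rule finite_subset[of _ "Pow V"]) auto

text \<open>A configuration on a disjoint union is a pair of configurations. As \<open>y\<close> is
  undefined off \<open>J\<close>, the glued function \<open>override_on y x I\<close> is again
  extensional on \<open>I \<union> J\<close>.\<close>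

lemma sum_PiE_Un:
  fixes f :: "('b \<Rightarrow> 'a) \<Rightarrow> 'c::comm_monoid_add"
  assumes "I \<inter> J = {}"
  shows "(\<Sum>\<eta>\<in>I \<union> J \<rightarrow>\<^sub>E UNIV. f \<eta>)
    = (\<Sum>x\<in>I \<rightarrow>\<^sub>E UNIV. \<Sum>y\<in>J \<rightarrow>\<^sub>E UNIV. f (override_on y x I))"
  unfolding sum.cartesian_product
  by (rule sum.reindex_bij_witness[where i = "\<lambda>(x, y). override_on y x I"
        and j = "\<lambda>\<eta>. (restrict \<eta> I, restrict \<eta> J)"])
    (use assms in \<open>auto simp: override_on_def restrict_def PiE_def extensional_def fun_eq_iff Int_def
      split: if_splits intro!: arg_cong[of _ _ f]\<close>)

lemma sum_PiE_insert:
  fixes f :: "('b \<Rightarrow> 'a) \<Rightarrow> 'c::comm_monoid_add"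
  assumes "t \<notin> T"
  shows "(\<Sum>\<eta>\<in>insert t T \<rightarrow>\<^sub>E UNIV. f \<eta>) = (\<Sum>x\<in>T \<rightarrow>\<^sub>E UNIV. \<Sum>a\<in>UNIV. f (x(t := a)))"
proof -
  have "(\<Sum>\<eta>\<in>insert t T \<rightarrow>\<^sub>E UNIV. f \<eta>)
      = (\<Sum>(a, x)\<in>UNIV \<times> (T \<rightarrow>\<^sub>E UNIV). f (x(t := a)))"
    by (subst PiE_insert_eq, subst sum.reindex[OF inj_combinator[OF assms]])
      (simp add: case_prod_beta comp_def)
  also have "\<dots> = (\<Sum>a\<in>UNIV. \<Sum>x\<in>T \<rightarrow>\<^sub>E UNIV. f (x(t := a)))"
    by (simp add: sum.cartesian_product)
  finally show ?thesis by (subst sum.swap)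
qed

lemma energy_scale: "energy (scale_interaction q U) V \<eta> = q * energy U V \<eta>"
  by (simp add: energy_def scale_interaction_def sum_distrib_left)

lemma partition_sum_pos: "finite V \<Longrightarrow> 0 < partition_sum U q V"
  unfolding partition_sum_def by (intro sum_pos finite_configs) (auto simp: PiE_eq_empty_iff)

section \<open>Almost additive sequences\<close>

text \<open>Splitting off one block of length \<open>n\<close> at a time costs one error
  \<open>D\<close> each.\<close>

lemma almost_additive_bound:
  fixes x :: "nat \<Rightarrow> real"
  assumes add: "\<And>m n. 1 \<le> m \<Longrightarrow> 1 \<le> n \<Longrightarrow> \<bar>x (m + n) - x m - x n\<bar> \<le> D"
  assumes "1 \<le> n" "1 \<le> m"
  shows "\<bar>x (m * n) - m * x n\<bar> \<le> m * D"
  using \<open>1 \<le> m\<close>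
proof (induction m rule: dec_induct)
  case base
  then show ?case using add[of 1 1] by simp
next
  case (step m)
  have "1 \<le> m * n" using step assms by simp
  from add[OF this \<open>1 \<le> n\<close>] step.IH show ?case by (simp add: algebra_simps)
qed

text \<open>Two-sided form of Fekete's argument: comparing \<open>x (m * n)\<close> with both
  \<open>m * x n\<close> and \<open>n * x m\<close> bounds the difference of the averages by
  \<open>D / m + D / n\<close>. This makes the averages Cauchy and, unlike plain subadditivity,
  keeps the error of \<open>x n\<close> against \<open>n * p\<close> bounded.\<close>

lemma almost_additive_limit:
  fixes x :: "nat \<Rightarrow> real"
  assumes add: "\<And>m n. 1 \<le> m \<Longrightarrow> 1 \<le> n \<Longrightarrow> \<bar>x (m + n) - x m - x n\<bar> \<le> D"
  obtains p where "(\<lambda>n. x n / n) \<longlonglongrightarrow> p" "\<And>n. 1 \<le> n \<Longrightarrow> \<bar>x n - n * p\<bar> \<le> D"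
proof -
  have D: "0 \<le> D" using add[of 1 1] by simp
  have diff: "\<bar>x m / m - x n / n\<bar> \<le> D / m + D / n" if "1 \<le> m" "1 \<le> n" for m n
  proof -
    have "\<bar>n * x m - m * x n\<bar> \<le> n * D + m * D"
      using almost_additive_bound[of x D n m, OF add] almost_additive_bound[of x D m n, OF add] that
      by (simp add: mult.commute)
    moreover have "x m / m - x n / n = (n * x m - m * x n) / (m * n)" "D / m + D / n = (n * D + m * D) / (m * n)"
      using that by (simp_all add: field_simps)
    ultimately show ?thesis using that by (simp add: abs_mult divide_right_mono)
  qed
  have "Cauchy (\<lambda>n. x n / n)"
  proof (rule metric_CauchyI)
    fix e :: real assume e: "0 < e"
    obtain M :: nat where M: "2 * D / e < M" using reals_Archimedean2 by blast
    have "dist (x m / m) (x n / n) < e" if "M + 1 \<le> m" "M + 1 \<le> n" for m n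
    proof -
      have *: "D / k < e / 2" if "M + 1 \<le> k" for k :: nat
      proof -
        have "2 * D / e < k" using M that by linarith
        then show ?thesis using e that by (simp add: field_simps)
      qed
      have "\<bar>x m / m - x n / n\<bar> \<le> D / m + D / n" using diff that by simp
      with *[OF that(1)] *[OF that(2)] show ?thesis unfolding dist_real_def by linarith
    qed
    then show "\<exists>M. \<forall>m\<ge>M. \<forall>n\<ge>M. dist (x m / m) (x n / n) < e" by blast
  qed
  then obtain p where p: "(\<lambda>n. x n / n) \<longlonglongrightarrow> p"
    using real_Cauchy_convergent convergent_def by blast
  have "\<bar>x n - n * p\<bar> \<le> D" if n: "1 \<le> n" for n
  proof -
    \<comment> \<open>The estimate \<open>diff\<close> is used with \<open>n\<close> fixed and
      \<open>m\<close> tending to infinity.\<close>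
    have "\<bar>x n / n - p\<bar> \<le> 0 + D / n"
    proof (rule LIMSEQ_le)
      show "(\<lambda>m. \<bar>x n / n - x m / m\<bar>) \<longlonglongrightarrow> \<bar>x n / n - p\<bar>"
        by (intro tendsto_intros p)
      show "(\<lambda>m. D / m + D / n) \<longlonglongrightarrow> 0 + D / n"
        by (intro tendsto_intros lim_const_over_n)
      show "\<exists>M. \<forall>m\<ge>M. \<bar>x n / n - x m / m\<bar> \<le> D / m + D / n"
        using diff n by (intro exI[of _ 1]) (metis abs_minus_commute)
    qed
    moreover have "x n - n * p = n * (x n / n - p)" using n by (simp add: field_simps)
    ultimately show ?thesis using n by (simp add: abs_mult field_simps)
  qed
  with p that show ?thesis by blast
qed

section \<open>Energies and partition sums of adjacent and translated intervals\<close>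

context bounded_interaction
begin

lemma D_nonneg: "0 \<le> D"
  using cross[of "{}"] by simp

lemma energy_cong: "(\<And>i. i \<in> V \<Longrightarrow> \<sigma> i = \<sigma>' i) \<Longrightarrow> energy U V \<sigma> = energy U V \<sigma>'"
  unfolding energy_def by (intro sum.cong refl local) auto

text \<open>A subset of the whole interval contained in neither half has sites on both sides of the
  bond \<open>b\<close>; these sets contribute at most \<open>D\<close> in total.\<close>

lemma energy_split:
  assumes "a \<le> b + 1" "b \<le> c"
  shows "\<bar>energy U {a..c} \<eta> - (energy U {a..b} \<eta> + energy U {b + 1..c} \<eta>)\<bar> \<le> D"
proof -
  let ?X = "{A\<in>crossing b. A \<subseteq> {a..c}}"
  have X: "finite ?X"
    by (rule finite_subset[of _ "Pow {a..c}"]) auto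
  have "{A\<in>fin_sets. A \<subseteq> {a..c}}
      = ({A\<in>fin_sets. A \<subseteq> {a..b}} \<union> {A\<in>fin_sets. A \<subseteq> {b + 1..c}}) \<union> ?X"
    using assms by (fastforce simp: crossing_def)
  moreover have "{A\<in>fin_sets. A \<subseteq> {a..b}} \<inter> {A\<in>fin_sets. A \<subseteq> {b + 1..c}} = {}"
    by (fastforce simp: fin_sets_def)
  moreover have "({A\<in>fin_sets. A \<subseteq> {a..b}} \<union> {A\<in>fin_sets. A \<subseteq> {b + 1..c}}) \<inter> ?X = {}"
    by (fastforce simp: crossing_def)
  ultimately have "energy U {a..c} \<eta> = energy U {a..b} \<eta> + energy U {b + 1..c} \<eta> + (\<Sum>A\<in>?X. U A \<eta>)"
    using X by (simp add: energy_def sum.union_disjoint finite_fin_subsets)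
  moreover have "\<bar>\<Sum>A\<in>?X. U A \<eta>\<bar> \<le> (\<Sum>A\<in>?X. N A)"
    by (intro order.trans[OF sum_abs] sum_mono abs_le) (auto simp: crossing_def)
  moreover have "(\<Sum>A\<in>?X. N A) \<le> D"
    using X by (rule cross) auto
  ultimately show ?thesis by linarith
qed

text \<open>The product of the two partition sums is a sum over the same pairs of configurations as
  the partition sum of the union, and by \<open>energy_split\<close> corresponding exponents differ
  by at most \<open>\<bar>q\<bar> * D\<close>.\<close>

lemma partition_sum_split:
  assumes "a \<le> b + 1" "b \<le> c"
  shows "\<bar>ln (partition_sum U q {a..c}) - ln (partition_sum U q {a..b}) - ln (partition_sum U q {b + 1..c})\<bar>
    \<le> \<bar>q\<bar> * D"
proof -
  let ?I = "{a..b}" and ?J = "{b + 1..c}"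
  have un: "{a..c} = ?I \<union> ?J" and disj: "?I \<inter> ?J = {}" using assms by auto
  have Z: "partition_sum U q {a..c} = (\<Sum>x\<in>?I \<rightarrow>\<^sub>E UNIV. \<Sum>y\<in>?J \<rightarrow>\<^sub>E UNIV.
      exp (- q * energy U {a..c} (override_on y x ?I)))"
    using sum_PiE_Un[OF disj, of "\<lambda>\<eta>. exp (- q * energy U {a..c} \<eta>)"]
    by (simp only: partition_sum_def un[symmetric])
  have prod: "partition_sum U q ?I * partition_sum U q ?J = (\<Sum>x\<in>?I \<rightarrow>\<^sub>E UNIV. \<Sum>y\<in>?J \<rightarrow>\<^sub>E UNIV.
      exp (- q * (energy U ?I x + energy U ?J y)))"
    by (simp add: partition_sum_def sum_product exp_add[symmetric] algebra_simps)
  have bound: "\<bar>q * energy U {a..c} (override_on y x ?I) - q * (energy U ?I x + energy U ?J y)\<bar> \<le> \<bar>q\<bar> * D" for x y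
  proof -
    have "energy U ?I (override_on y x ?I) = energy U ?I x"
      "energy U ?J (override_on y x ?I) = energy U ?J y"
      by (auto intro!: energy_cong simp: override_on_def)
    with energy_split[OF assms, of "override_on y x ?I"]
    have "\<bar>energy U {a..c} (override_on y x ?I) - (energy U ?I x + energy U ?J y)\<bar> \<le> D" by simp
    from mult_left_mono[OF this, of "\<bar>q\<bar>"] show ?thesis
      by (simp add: abs_mult[symmetric] right_diff_distrib)
  qed
  have ub: "partition_sum U q {a..c} \<le> exp (\<bar>q\<bar> * D) * (partition_sum U q ?I * partition_sum U q ?J)"
    unfolding Z prod sum_distrib_left mult_exp_exp
    by (intro sum_mono, subst exp_le_cancel_iff) (use bound in \<open>simp add: abs_le_iff algebra_simps\<close>)
  have lb: "exp (- (\<bar>q\<bar> * D)) * (partition_sum U q ?I * partition_sum U q ?J) \<le> partition_sum U q {a..c}"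
    unfolding Z prod sum_distrib_left mult_exp_exp
    by (intro sum_mono, subst exp_le_cancel_iff) (use bound in \<open>simp add: abs_le_iff algebra_simps\<close>)
  have pos: "0 < partition_sum U q V" if "finite V" for V by (rule partition_sum_pos[OF that])
  have "ln (partition_sum U q {a..c}) \<le> \<bar>q\<bar> * D + (ln (partition_sum U q ?I) + ln (partition_sum U q ?J))"
    using ub pos[of "{a..c}"] pos[of ?I] pos[of ?J]
    by (subst (asm) ln_le_cancel_iff[symmetric]) (auto simp: ln_mult)
  moreover have "- (\<bar>q\<bar> * D) + (ln (partition_sum U q ?I) + ln (partition_sum U q ?J)) \<le> ln (partition_sum U q {a..c})"
    using lb pos[of "{a..c}"] pos[of ?I] pos[of ?J]
    by (subst (asm) ln_le_cancel_iff[symmetric]) (auto simp: ln_mult)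
  ultimately show ?thesis by linarith
qed

lemma energy_translate: "energy U ((\<lambda>j. j + i) ` V) (shift (- i) \<eta>) = energy U V \<eta>"
proof -
  have inj: "inj_on ((`) (\<lambda>j. j + i)) {A\<in>fin_sets. A \<subseteq> V}"
    by (intro inj_on_image inj_onI) simp
  have im: "(`) (\<lambda>j. j + i) ` {A\<in>fin_sets. A \<subseteq> V} = {A\<in>fin_sets. A \<subseteq> (\<lambda>j. j + i) ` V}"
  proof (intro set_eqI iffI)
    fix B assume B: "B \<in> {A\<in>fin_sets. A \<subseteq> (\<lambda>j. j + i) ` V}"
    then obtain A where "A \<subseteq> V" "B = (\<lambda>j. j + i) ` A" by (auto simp: subset_image_iff)
    with B show "B \<in> (`) (\<lambda>j. j + i) ` {A\<in>fin_sets. A \<subseteq> V}" by auto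
  qed auto
  have "energy U ((\<lambda>j. j + i) ` V) (shift (- i) \<eta>)
      = (\<Sum>A\<in>{A\<in>fin_sets. A \<subseteq> V}. U ((\<lambda>j. j + i) ` A) (shift (- i) \<eta>))"
    by (simp add: energy_def im[symmetric] sum.reindex[OF inj])
  also have "\<dots> = energy U V \<eta>"
    unfolding energy_def by (intro sum.cong refl translate) auto
  finally show ?thesis .
qed

lemma partition_sum_translate: "partition_sum U q {a + i..b + i} = partition_sum U q {a..b}"
  unfolding partition_sum_def
proof (rule sum.reindex_bij_witness[where i = "shift (- i)" and j = "shift i"])
  fix \<eta> :: "int \<Rightarrow> 'a"
  have "(\<lambda>j. j + i) ` {a..b} = {a + i..b + i}" by simp
  with energy_translate[of i "{a..b}" "shift i \<eta>"]
  show "exp (- q * energy U {a..b} (shift i \<eta>)) = exp (- q * energy U {a + i..b + i} \<eta>)"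
    by (simp add: shift_def)
qed (auto simp: shift_def PiE_def extensional_def)

text \<open>Cutting a block and translating the second piece back to start at 1 shows that the
  logarithms of the partition sums are almost additive. Hence the limit defining the pressure exists
  and is approached with bounded total error.\<close>

lemma pressure_bound:
  assumes "1 \<le> k"
  shows "\<bar>ln (partition_sum U q (block k)) - k * pressure (scale_interaction q U)\<bar> \<le> \<bar>q\<bar> * D"
proof -
  define x where "x n = ln (partition_sum U q (block (int n)))" for n
  have add: "\<bar>x (m + n) - x m - x n\<bar> \<le> \<bar>q\<bar> * D" if "1 \<le> m" "1 \<le> n" for m n
    using partition_sum_split[of 1 "int m" "int (m + n)" q] partition_sum_translate[of q 1 "int m" "int n"]
    by (simp add: x_def add.commute)
  obtain p where lim: "(\<lambda>n. x n / n) \<longlonglongrightarrow> p" and le: "\<And>n. 1 \<le> n \<Longrightarrow> \<bar>x n - n * p\<bar> \<le> \<bar>q\<bar> * D"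
    using almost_additive_limit[of x, OF add] by blast
  have "pressure (scale_interaction q U) = lim (\<lambda>n. x n / n)"
  proof -
    have "- q * energy U V \<eta> = - energy (scale_interaction q U) V \<eta>" for V \<eta>
      by (simp add: energy_scale)
    then show ?thesis by (simp add: pressure_def x_def partition_sum_def) (simp add: energy_def)
  qed
  also have "\<dots> = p" using lim by (rule limI)
  finally show ?thesis using le[of "nat k"] assms by (simp add: x_def)
qed

section \<open>The effect of changing letters\<close>

text \<open>Only sets containing \<open>t\<close> notice the change, and each such term moves by at
  most \<open>2 * N A\<close>.\<close>

lemma energy_flip:
  assumes "finite V"
  shows "\<bar>energy U V (\<eta>(t := b)) - energy U V \<eta>\<bar> \<le> 2 * S"
proof -
  let ?F = "{A\<in>fin_sets. A \<subseteq> V}"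
  have "energy U V (\<eta>(t := b)) - energy U V \<eta> = (\<Sum>A\<in>?F. U A (\<eta>(t := b)) - U A \<eta>)"
    by (simp add: energy_def sum_subtractf)
  also have "\<bar>\<dots>\<bar> \<le> (\<Sum>A\<in>?F. \<bar>U A (\<eta>(t := b)) - U A \<eta>\<bar>)" by (rule sum_abs)
  also have "\<dots> = (\<Sum>A\<in>{A\<in>?F. t \<in> A}. \<bar>U A (\<eta>(t := b)) - U A \<eta>\<bar>)"
  proof (intro sum.mono_neutral_right finite_fin_subsets ballI assms)
    fix A assume "A \<in> ?F - {A\<in>?F. t \<in> A}"
    then have "U A (\<eta>(t := b)) = U A \<eta>" by (intro local) auto
    then show "\<bar>U A (\<eta>(t := b)) - U A \<eta>\<bar> = 0" by simp
  qed auto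
  also have "\<dots> \<le> (\<Sum>A\<in>{A\<in>?F. t \<in> A}. 2 * N A)"
  proof (rule sum_mono)
    fix A assume "A \<in> {A\<in>?F. t \<in> A}"
    then show "\<bar>U A (\<eta>(t := b)) - U A \<eta>\<bar> \<le> 2 * N A"
      using abs_le[of A "\<eta>(t := b)"] abs_le[of A \<eta>] by (simp del: fun_upd_apply)
  qed
  also have "\<dots> \<le> 2 * S"
    unfolding sum_distrib_left[symmetric]
    by (intro mult_left_mono site[of _ t] finite_subset[OF _ finite_fin_subsets[OF assms]]) auto
  finally show ?thesis .
qed

text \<open>Freeing one more site allows at least one further letter there, whose Boltzmann weight
  is at least \<open>exp (- (2 * S))\<close> times the original one. Each freed site thus gains a
  factor \<open>1 + exp (- (2 * S))\<close>.\<close>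

lemma weight_le_partial_sum:
  assumes card: "CARD('a) \<ge> 2" and V: "finite V" and T: "finite T"
  shows "(1 + exp (- (2 * S))) ^ card T * exp (- energy U V \<eta>)
    \<le> (\<Sum>\<xi>\<in>T \<rightarrow>\<^sub>E UNIV. exp (- energy U V (override_on \<eta> \<xi> T)))"
  using T
proof (induction T rule: finite_induct)
  case empty
  then show ?case by simp
next
  case (insert t T)
  let ?c = "1 + exp (- (2 * S))"
  have "?c ^ card (insert t T) * exp (- energy U V \<eta>) = ?c * (?c ^ card T * exp (- energy U V \<eta>))"
    using insert by simp
  also have "\<dots> \<le> ?c * (\<Sum>\<xi>\<in>T \<rightarrow>\<^sub>E UNIV. exp (- energy U V (override_on \<eta> \<xi> T)))"
    using insert.IH by (intro mult_left_mono) (auto intro: add_nonneg_nonneg)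
  also have "\<dots> \<le> (\<Sum>\<xi>\<in>T \<rightarrow>\<^sub>E UNIV. \<Sum>a\<in>UNIV. exp (- energy U V ((override_on \<eta> \<xi> T)(t := a))))"
    unfolding sum_distrib_left
  proof (rule sum_mono)
    fix \<xi>
    define \<eta>' where "\<eta>' = override_on \<eta> \<xi> T"
    \<comment> \<open>The only place where the alphabet must have a second letter.\<close>
    have "\<exists>b. b \<noteq> \<eta>' t"
    proof (rule ccontr)
      assume "\<nexists>b. b \<noteq> \<eta>' t"
      then have "(UNIV :: 'a set) = {\<eta>' t}" by auto
      then have "CARD('a) = card {\<eta>' t}" by (rule arg_cong)
      with card show False by simp
    qed
    then obtain b where b: "b \<noteq> \<eta>' t" ..
    have "?c * exp (- energy U V \<eta>') = exp (- energy U V \<eta>') + exp (- 2 * S - energy U V \<eta>')"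
      by (simp add: algebra_simps mult_exp_exp)
    also have "\<dots> \<le> exp (- energy U V (\<eta>'(t := \<eta>' t))) + exp (- energy U V (\<eta>'(t := b)))"
      using energy_flip[OF V, of \<eta>' t b] by (simp add: abs_le_iff)
    also have "\<dots> = (\<Sum>a\<in>{\<eta>' t, b}. exp (- energy U V (\<eta>'(t := a))))"
      using b by simp
    also have "\<dots> \<le> (\<Sum>a\<in>UNIV. exp (- energy U V (\<eta>'(t := a))))"
      by (intro sum_mono2) auto
    finally show "?c * exp (- energy U V (override_on \<eta> \<xi> T))
        \<le> (\<Sum>a\<in>UNIV. exp (- energy U V ((override_on \<eta> \<xi> T)(t := a))))"
      by (simp add: \<eta>'_def)
  qed
  also have "\<dots> = (\<Sum>\<xi>\<in>insert t T \<rightarrow>\<^sub>E UNIV. exp (- energy U V (override_on \<eta> \<xi> (insert t T))))"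
  proof -
    have "(override_on \<eta> \<xi> T)(t := a) = override_on \<eta> (\<xi>(t := a)) (insert t T)" for \<xi> a
      by (auto simp: override_on_def fun_eq_iff)
    then show ?thesis using insert by (simp add: sum_PiE_insert)
  qed
  finally show ?case .
qed

lemma weight_le_partition_sum:
  assumes "CARD('a) \<ge> 2" "finite V"
  shows "(1 + exp (- (2 * S))) ^ card V * exp (- energy U V \<eta>) \<le> partition_sum U 1 V"
proof -
  have "energy U V (override_on \<eta> \<xi> V) = energy U V \<xi>" for \<xi>
    by (rule energy_cong) simp
  then show ?thesis
    using weight_le_partial_sum[OF assms assms(2), of \<eta>] by (simp add: partition_sum_def)
qed

section \<open>The collision ratio and positivity of \<alpha>\<close>

text \<open>The probability that two independent words drawn from the free-boundary Gibbs
  distribution on a block of length \<open>k\<close> coincide; \<open>sum_weight_square\<close>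
  exhibits it as a sum of squared weights.\<close>

definition collision :: "int \<Rightarrow> real" where
  "collision k = partition_sum U 2 (block k) / (partition_sum U 1 (block k))\<^sup>2"

lemma collision_pos: "0 < collision k"
  unfolding collision_def by (intro divide_pos_pos zero_less_power partition_sum_pos) auto

text \<open>The pressure bound is used once at \<open>q = 2\<close>, with error
  \<open>2 * D\<close>, and twice at \<open>q = 1\<close>, with error \<open>D\<close> each; the
  linear terms combine to \<open>- 2 * k * alpha U\<close>.\<close>

lemma ln_collision_bound:
  assumes "1 \<le> k"
  shows "\<bar>ln (collision k) + 2 * k * alpha U\<bar> \<le> 4 * D"
proof -
  have pos: "0 < partition_sum U q (block k)" for q by (simp add: partition_sum_pos)
  have "ln (collision k) = ln (partition_sum U 2 (block k)) - 2 * ln (partition_sum U 1 (block k))"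
    using pos[of 1] pos[of 2] by (simp add: collision_def ln_div ln_realpow)
  moreover have "scale_interaction 1 U = U" by (simp add: scale_interaction_def)
  ultimately show ?thesis
    using pressure_bound[OF assms, of 1] pressure_bound[OF assms, of 2]
    by (simp add: alpha_def algebra_simps)
qed

lemma collision_bounds:
  assumes "1 \<le> k"
  shows "collision k \<le> exp (4 * D) * exp (- 2 * alpha U * k)"
    and "exp (- 4 * D) * exp (- 2 * alpha U * k) \<le> collision k"
proof -
  have "collision k = exp (ln (collision k))" using collision_pos[of k] by simp
  moreover have "ln (collision k) \<le> 4 * D + - 2 * alpha U * k" "- 4 * D + - 2 * alpha U * k \<le> ln (collision k)"
    using ln_collision_bound[OF assms] by (simp_all add: abs_le_iff algebra_simps)
  ultimately show "collision k \<le> exp (4 * D) * exp (- 2 * alpha U * k)"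
    "exp (- 4 * D) * exp (- 2 * alpha U * k) \<le> collision k"
    by (metis exp_le_cancel_iff mult_exp_exp)+
qed

text \<open>With c = 1 + e^(-2S), every word of length k has weight at most c^(-k), so the collision
  ratio is at most c^(-k). Comparison with its exact exponential rate forces 2 \<alpha> to be at
  least ln c.\<close>

lemma alpha_pos:
  assumes "CARD('a) \<ge> 2"
  shows "0 < alpha U"
proof -
  let ?c = "1 + exp (- (2 * S))"
  have c: "1 < ?c" by simp
  have *: "real k * (ln ?c - 2 * alpha U) \<le> 4 * D" if k: "1 \<le> k" for k :: nat
  proof -
    let ?Z = "partition_sum U 1 (block k)"
    have Z: "0 < ?Z" by (simp add: partition_sum_pos)
    have "?c ^ k * partition_sum U 2 (block k)
        = (\<Sum>\<eta>\<in>block k \<rightarrow>\<^sub>E UNIV. (?c ^ k * exp (- energy U (block k) \<eta>)) * exp (- energy U (block k) \<eta>))"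
      by (simp add: partition_sum_def sum_distrib_left exp_add[symmetric] mult.assoc)
    also have "\<dots> \<le> (\<Sum>\<eta>\<in>block k \<rightarrow>\<^sub>E UNIV. ?Z * exp (- energy U (block k) \<eta>))"
      using weight_le_partition_sum[OF assms, of "block k"] by (intro sum_mono mult_right_mono) auto
    also have "\<dots> = ?Z\<^sup>2"
      by (simp add: partition_sum_def sum_distrib_left power2_eq_square)
    finally have "?c ^ k * collision k \<le> 1"
      using Z by (simp add: collision_def field_simps)
    moreover have "0 < ?c ^ k * collision k" using c collision_pos by (intro mult_pos_pos zero_less_power) (auto intro: add_pos_pos)
    ultimately have "ln (?c ^ k * collision k) \<le> 0" by simp
    then have "k * ln ?c + ln (collision k) \<le> 0"
      using c collision_pos[of k] by (simp add: ln_mult ln_realpow)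
    with ln_collision_bound[of k] k show ?thesis by (simp add: algebra_simps abs_le_iff)
  qed
  \<comment> \<open>A positive difference would make the left side of the previous inequality grow
    linearly in \<open>k\<close>.\<close>
  have "ln ?c \<le> 2 * alpha U"
  proof (rule ccontr)
    assume "\<not> ?thesis"
    then have pos: "0 < ln ?c - 2 * alpha U" by simp
    obtain k :: nat where "4 * D / (ln ?c - 2 * alpha U) < k" using reals_Archimedean2 by blast
    then have "4 * D < real (k + 1) * (ln ?c - 2 * alpha U)" using pos by (simp add: field_simps)
    with *[of "k + 1"] show False by simp
  qed
  moreover have "0 < ln ?c" using c by (intro ln_gt_zero)
  ultimately show ?thesis by linarith
qed

end

section \<open>Block and match probabilities of a Gibbs measure\<close>

lemma space_config_space [simp]: "space config_space = UNIV"
  by (simp add: config_space_def space_PiM)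

text \<open>The word \<open>x\<close> need not be extensional, so shifted and periodically extended
  words can be inserted directly.\<close>

definition cylinder :: "int set \<Rightarrow> (int \<Rightarrow> 'a) \<Rightarrow> (int \<Rightarrow> 'a) set" where
  "cylinder V x = {\<sigma>. \<forall>i\<in>V. \<sigma> i = x i}"

definition match :: "int \<Rightarrow> int \<Rightarrow> int \<Rightarrow> (int \<Rightarrow> 'a) set" where
  "match i j k = {\<sigma>. \<forall>l\<in>block k. \<sigma> (i + l) = \<sigma> (j + l)}"

lemma match_sym: "match i j k = match j i k"
  by (auto simp: match_def)

lemma cylinder_in_sub_field:
  assumes "finite V" "V \<subseteq> W"
  shows "cylinder V x \<in> sets (sub_field W)"
proof (cases "V = {}")
  case True
  then show ?thesis using sets.top[of "sub_field W"] by (simp add: cylinder_def)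
next
  case False
  have "{\<sigma> \<in> space (sub_field W). \<forall>i\<in>V. \<sigma> i = x i} \<in> sets (sub_field W)"
  proof (rule sets.sets_Collect_finite_All'[OF _ assms(1) False])
    fix i assume "i \<in> V"
    then have "\<exists>j B. {\<sigma>. \<sigma> i = x i} = {\<sigma>. \<sigma> j \<in> B} \<and> j \<in> W"
      using assms by (intro exI[of _ i] exI[of _ "{x i}"]) auto
    then have "{\<sigma>. \<sigma> i = x i} \<in> sigma_sets UNIV {{\<sigma>. \<sigma> i \<in> B} | i B. i \<in> W}"
      by (intro sigma_sets.Basic) blast
    then show "{\<sigma> \<in> space (sub_field W). \<sigma> i = x i} \<in> sets (sub_field W)"
      by (simp add: sub_field_def)
  qed
  then show ?thesis by (simp add: cylinder_def)
qed

lemma restrict_eq_cylinder: "{\<sigma>. restrict \<sigma> V = restrict x V} = cylinder V x"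
  by (auto simp: cylinder_def restrict_def fun_eq_iff)

lemma disjoint_cylinders:
  fixes B :: "(int \<Rightarrow> 'a) \<Rightarrow> (int \<Rightarrow> 'a) set"
  shows "disjoint_family_on (\<lambda>\<eta>. cylinder V \<eta> \<inter> B \<eta>) (V \<rightarrow>\<^sub>E UNIV)"
  unfolding disjoint_family_on_def
proof (intro ballI impI)
  fix \<eta> \<eta>' :: "int \<Rightarrow> 'a"
  assume "\<eta> \<in> V \<rightarrow>\<^sub>E UNIV" "\<eta>' \<in> V \<rightarrow>\<^sub>E UNIV" "\<eta> \<noteq> \<eta>'"
  then obtain i where "i \<in> V" "\<eta> i \<noteq> \<eta>' i" using PiE_ext by blast
  then show "(cylinder V \<eta> \<inter> B \<eta>) \<inter> (cylinder V \<eta>' \<inter> B \<eta>') = {}"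
    by (auto simp: cylinder_def)
qed

section \<open>Influence of the boundary condition, and normalised block weights\<close>

context bounded_interaction
begin

text \<open>These are the sets that enter the Hamiltonian but not the inner energy.\<close>

definition boundary :: "int set \<Rightarrow> int set set" where
  "boundary V = {A\<in>fin_sets. A \<inter> V \<noteq> {} \<and> \<not> A \<subseteq> V}"

text \<open>A set leaving the interval crosses the bond at its right end, \<open>b\<close>, or the
  one at its left end, \<open>a - 1\<close>; each bond accounts for \<open>D\<close>.\<close>

lemma boundary_sum_le:
  assumes F: "finite F" "F \<subseteq> boundary {a..b}"
  shows "sum N F \<le> 2 * D"
proof -
  have "sum N F = sum N (F \<inter> crossing b) + sum N (F - crossing b)"
    using F(1) by (rule sum.Int_Diff)
  also have "\<dots> \<le> D + D"
  proof (intro add_mono cross)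
    show "F - crossing b \<subseteq> crossing (a - 1)"
    proof
      fix A assume A: "A \<in> F - crossing b"
      then have "A \<in> fin_sets" "A \<inter> {a..b} \<noteq> {}" "\<not> A \<subseteq> {a..b}"
        using F by (auto simp: boundary_def)
      then obtain x y where "A \<in> fin_sets" "x \<in> A" "a \<le> x" "x \<le> b" "y \<in> A" "y < a \<or> b < y"
        by fastforce
      moreover from this A have "\<not> b < y" by (auto simp: crossing_def)
      ultimately have "A \<in> fin_sets" "x \<in> A" "a - 1 < x" "y \<in> A" "y \<le> a - 1" by auto
      then show "A \<in> crossing (a - 1)" unfolding crossing_def by blast
    qed
  qed (use F in auto)
  finally show ?thesis by simp
qed

text \<open>The difference is the sum over the boundary sets. Its finite absolute partial sums are
  at most \<open>2 * D\<close>, which gives both convergence and a bound uniform in the boundary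
  condition \<open>\<zeta>\<close>.\<close>

lemma hamiltonian_bound:
  "\<bar>hamiltonian U {a..b} \<zeta> \<eta> - energy U {a..b} \<eta>\<bar> \<le> 2 * D"
proof -
  let ?V = "{a..b}" and ?f = "\<lambda>A. U A (override_on \<zeta> \<eta> {a..b})"
  let ?B = "boundary {a..b}"
  have f_le: "norm (?f A) \<le> N A" if "A \<in> fin_sets" for A
    using abs_le[OF that] by simp
  have F_le: "(\<Sum>A\<in>F. norm (?f A)) \<le> 2 * D" if "finite F" "F \<subseteq> ?B" for F
    by (rule order.trans[OF sum_mono[of F _ N] boundary_sum_le[OF that]])
      (use that f_le in \<open>auto simp: boundary_def\<close>)
  then have summ: "(\<lambda>A. norm (?f A)) summable_on ?B"
    by (intro nonneg_bdd_above_summable_on bdd_aboveI2[where M = "2 * D"]) auto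
  have "{A\<in>fin_sets. A \<inter> ?V \<noteq> {}} = {A\<in>fin_sets. A \<subseteq> ?V} \<union> ?B"
    by (auto simp: boundary_def fin_sets_def)
  then have "hamiltonian U ?V \<zeta> \<eta> = (\<Sum>\<^sub>\<infinity>A\<in>{A\<in>fin_sets. A \<subseteq> ?V} \<union> ?B. ?f A)"
    unfolding hamiltonian_def by (rule arg_cong)
  also have "\<dots> = (\<Sum>\<^sub>\<infinity>A\<in>{A\<in>fin_sets. A \<subseteq> ?V}. ?f A) + (\<Sum>\<^sub>\<infinity>A\<in>?B. ?f A)"
    by (rule infsum_Un_disjoint[OF summable_on_finite[OF finite_fin_subsets] abs_summable_summable[OF summ]])
      (auto simp: boundary_def)
  also have "(\<Sum>\<^sub>\<infinity>A\<in>{A\<in>fin_sets. A \<subseteq> ?V}. ?f A) = energy U ?V (override_on \<zeta> \<eta> ?V)"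
    by (simp add: energy_def finite_fin_subsets)
  also have "\<dots> = energy U ?V \<eta>" by (rule energy_cong) simp
  finally have "hamiltonian U ?V \<zeta> \<eta> - energy U ?V \<eta> = (\<Sum>\<^sub>\<infinity>A\<in>?B. ?f A)" by simp
  moreover have "norm (\<Sum>\<^sub>\<infinity>A\<in>?B. ?f A) \<le> (\<Sum>\<^sub>\<infinity>A\<in>?B. norm (?f A))"
    by (rule norm_infsum_bound[OF summ])
  moreover have "\<dots> \<le> 2 * D"
    by (rule infsum_le_finite_sums[OF summ F_le])
  ultimately show ?thesis by simp
qed

definition weight :: "int set \<Rightarrow> (int \<Rightarrow> 'a) \<Rightarrow> real" where
  "weight V \<eta> = exp (- energy U V \<eta>) / partition_sum U 1 V"

lemma weight_nonneg: "finite V \<Longrightarrow> 0 \<le> weight V \<eta>"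
  by (simp add: weight_def less_imp_le partition_sum_pos)

lemma weight_cong: "(\<And>i. i \<in> V \<Longrightarrow> \<sigma> i = \<sigma>' i) \<Longrightarrow> weight V \<sigma> = weight V \<sigma>'"
  using energy_cong[of V \<sigma> \<sigma>'] by (simp add: weight_def)

lemma weight_translate: "weight {a + i..b + i} (shift (- i) \<eta>) = weight {a..b} \<eta>"
  using energy_translate[of i "{a..b}" \<eta>] by (simp add: weight_def partition_sum_translate)

text \<open>Squaring a Boltzmann factor doubles the energy, so the sum of squares has the partition
  sum at \<open>q = 2\<close> as numerator.\<close>

lemma sum_weight_square: "(\<Sum>\<eta>\<in>{a + 1..a + k} \<rightarrow>\<^sub>E UNIV. (weight {a + 1..a + k} \<eta>)\<^sup>2) = collision k"
proof -
  let ?V = "{a + 1..a + k}"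
  have "(\<Sum>\<eta>\<in>?V \<rightarrow>\<^sub>E UNIV. (weight ?V \<eta>)\<^sup>2) = partition_sum U 2 ?V / (partition_sum U 1 ?V)\<^sup>2"
    by (simp add: weight_def power_divide partition_sum_def flip: sum_divide_distrib exp_double)
  then show ?thesis
    using partition_sum_translate[of _ 1 a k] by (simp add: collision_def add.commute)
qed

text \<open>A single squared weight is one term of the sum of squares.\<close>

lemma weight_le_sqrt_collision: "weight {a + 1..a + k} \<eta> \<le> sqrt (collision k)"
proof -
  let ?V = "{a + 1..a + k}"
  have "(weight ?V (restrict \<eta> ?V))\<^sup>2 \<le> (\<Sum>\<eta>\<in>?V \<rightarrow>\<^sub>E UNIV. (weight ?V \<eta>)\<^sup>2)"
    by (rule member_le_sum) (auto intro: finite_configs)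
  moreover have "weight ?V (restrict \<eta> ?V) = weight ?V \<eta>" by (rule weight_cong) simp
  ultimately show ?thesis by (simp add: sum_weight_square real_le_rsqrt)
qed

text \<open>Numerator and denominator each differ from their free-boundary counterparts by a factor
  at most \<open>exp (2 * D)\<close>.\<close>

lemma gibbs_ratio_bounds:
  fixes \<zeta> \<eta> :: "int \<Rightarrow> 'a"
  defines "R \<equiv> \<lambda>V. exp (- hamiltonian U V \<zeta> \<eta>) / (\<Sum>\<eta>'\<in>V \<rightarrow>\<^sub>E UNIV. exp (- hamiltonian U V \<zeta> \<eta>'))"
  shows "R {a..b} \<le> exp (4 * D) * weight {a..b} \<eta>"
    and "exp (- 4 * D) * weight {a..b} \<eta> \<le> R {a..b}"
proof -
  let ?V = "{a..b}"
  let ?Z = "\<Sum>\<eta>'\<in>?V \<rightarrow>\<^sub>E UNIV. exp (- hamiltonian U ?V \<zeta> \<eta>')"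
  have up: "exp (- hamiltonian U ?V \<zeta> \<eta>) \<le> exp (2 * D) * exp (- energy U ?V \<eta>)"
    and lo: "exp (- 2 * D) * exp (- energy U ?V \<eta>) \<le> exp (- hamiltonian U ?V \<zeta> \<eta>)" for \<eta>
    using hamiltonian_bound[of a b \<zeta> \<eta>] by (simp_all add: mult_exp_exp abs_le_iff)
  have Z: "partition_sum U 1 ?V = (\<Sum>\<eta>'\<in>?V \<rightarrow>\<^sub>E UNIV. exp (- energy U ?V \<eta>'))"
    by (simp add: partition_sum_def)
  have Zpos: "0 < partition_sum U 1 ?V" by (simp add: partition_sum_pos)
  have Zup: "?Z \<le> exp (2 * D) * partition_sum U 1 ?V"
    unfolding Z sum_distrib_left by (intro sum_mono up)
  have Zlo: "exp (- 2 * D) * partition_sum U 1 ?V \<le> ?Z"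
    unfolding Z sum_distrib_left by (intro sum_mono lo)
  have Zpos': "0 < ?Z" using Zlo Zpos by (smt (verit) exp_gt_zero mult_pos_pos)
  have "R ?V \<le> (exp (2 * D) * exp (- energy U ?V \<eta>)) / (exp (- 2 * D) * partition_sum U 1 ?V)"
    unfolding R_def using Zpos by (intro frac_le up Zlo) auto
  also have "\<dots> = (exp (2 * D) / exp (- 2 * D)) * weight ?V \<eta>" by (simp add: weight_def)
  also have "exp (2 * D) / exp (- 2 * D) = exp (4 * D)" by (simp flip: exp_diff)
  finally show "R ?V \<le> exp (4 * D) * weight ?V \<eta>" .
  have "exp (- 4 * D) = exp (- 2 * D) / exp (2 * D)" by (simp flip: exp_diff)
  then have "exp (- 4 * D) * weight ?V \<eta>
      = (exp (- 2 * D) * exp (- energy U ?V \<eta>)) / (exp (2 * D) * partition_sum U 1 ?V)"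
    by (simp add: weight_def)
  also have "\<dots> \<le> R ?V"
    unfolding R_def using Zpos' by (intro frac_le lo Zup) auto
  finally show "exp (- 4 * D) * weight ?V \<eta> \<le> R ?V" .
qed

end

section \<open>Probabilities of words under the Gibbs measure\<close>

locale gibbs_system = bounded_interaction U N S D
  for U :: "('a::finite) interaction" and N S D +
  fixes P :: "(int \<Rightarrow> 'a) measure"
  assumes gibbs: "gibbs_measure U P"
begin

sublocale prob_space P
  using gibbs by (simp add: gibbs_measure_def)

lemma sets_P: "sets P = sets config_space"
  using gibbs by (simp add: gibbs_measure_def)

lemma space_P [simp]: "space P = UNIV"
  using sets_eq_imp_space_eq[OF sets_P] by simp

lemma subalgebra_P: "subalgebra P (sub_field V)"
  using subalgebra_sub_field[of V] by (simp add: subalgebra_def sets_P)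

lemma sub_field_sets_P: "B \<in> sets (sub_field V) \<Longrightarrow> B \<in> sets P"
  using subalgebra_P by (auto simp: subalgebra_def)

lemma cylinder_sets: "finite V \<Longrightarrow> cylinder V x \<in> sets P"
  using cylinder_in_sub_field[of V V x] sub_field_sets_P by blast

text \<open>Quasi-independence of a block from its exterior: the conditional probability of the word
  lies almost surely between constant multiples of its weight, and integrating it over the exterior
  event \<open>B\<close> gives the claim.\<close>

lemma conditional_bounds:
  assumes ab: "a \<le> b" and B: "B \<in> sets (sub_field (- {a..b}))"
  shows "prob (cylinder {a..b} x \<inter> B) \<le> exp (4 * D) * weight {a..b} x * prob B"
    and "exp (- 4 * D) * weight {a..b} x * prob B \<le> prob (cylinder {a..b} x \<inter> B)"
proof -
  let ?V = "{a..b}" and ?F = "sub_field (- {a..b}) :: (int \<Rightarrow> 'a) measure"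
  interpret F: finite_measure_subalgebra P ?F
    by unfold_locales (rule subalgebra_P)
  let ?C = "cylinder ?V x"
  let ?g = "real_cond_exp P ?F (indicator ?C)"
  \<comment> \<open>The Gibbs condition is stated for extensional words, hence the passage from
    \<open>x\<close> to its restriction.\<close>
  define \<eta> where "\<eta> = restrict x ?V"
  have C: "?C = {\<sigma>. restrict \<sigma> ?V = \<eta>}"
    by (simp add: restrict_eq_cylinder \<eta>_def)
  have w: "weight ?V \<eta> = weight ?V x" by (rule weight_cong) (simp add: \<eta>_def)
  have "?V \<in> fin_sets" using ab by (simp add: fin_sets_def)
  with gibbs have ae0: "AE \<zeta> in P. \<forall>\<eta>\<in>?V \<rightarrow>\<^sub>E UNIV.
        real_cond_exp P ?F (indicator {\<sigma>. restrict \<sigma> ?V = \<eta>}) \<zeta> =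
        exp (- hamiltonian U ?V \<zeta> \<eta>) / (\<Sum>\<eta>'\<in>?V \<rightarrow>\<^sub>E UNIV. exp (- hamiltonian U ?V \<zeta> \<eta>'))"
    by (auto simp: gibbs_measure_def)
  have \<eta>: "\<eta> \<in> ?V \<rightarrow>\<^sub>E UNIV" by (simp add: \<eta>_def)
  have ae: "AE \<zeta> in P. exp (- 4 * D) * weight ?V x \<le> ?g \<zeta> \<and> ?g \<zeta> \<le> exp (4 * D) * weight ?V x"
    using ae0
  proof (eventually_elim)
    case (elim \<zeta>)
    have "?g \<zeta> = exp (- hamiltonian U ?V \<zeta> \<eta>) / (\<Sum>\<eta>'\<in>?V \<rightarrow>\<^sub>E UNIV. exp (- hamiltonian U ?V \<zeta> \<eta>'))"
      using bspec[OF elim \<eta>] by (simp only: C)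
    then show ?case
      using gibbs_ratio_bounds[where a = a and b = b and \<zeta> = \<zeta> and \<eta> = \<eta>] by (simp only: w)
  qed
  have BP: "B \<in> sets P" using sub_field_sets_P B by blast
  have CP: "?C \<in> sets P" by (rule cylinder_sets) simp
  have int: "integrable P (indicator ?C :: _ \<Rightarrow> real)"
    using CP by (intro integrable_real_indicator) (simp_all add: emeasure_eq_measure)
  have "prob (?C \<inter> B) = (\<integral>x\<in>B. indicator ?C x \<partial>P)"
    unfolding set_lebesgue_integral_def by (simp add: Int_commute flip: indicator_inter_arith)
  also have "\<dots> = (\<integral>x\<in>B. ?g x \<partial>P)"
    by (rule F.real_cond_exp_intA[OF int B])
  finally have eq: "prob (?C \<inter> B) = (\<integral>x. indicator B x * ?g x \<partial>P)"
    by (simp add: set_lebesgue_integral_def)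
  have int_g: "integrable P (\<lambda>x. indicator B x * ?g x)"
    using integrable_mult_indicator[OF BP F.real_cond_exp_int(1)[OF int]] by simp
  have int_c: "integrable P (\<lambda>x. indicator B x * c)" for c :: real
    using BP by (intro integrable_mult_left integrable_real_indicator) (simp_all add: emeasure_eq_measure)
  have c: "(\<integral>x. indicator B x * c \<partial>P) = c * prob B" for c :: real
    using BP by simp
  show "prob (?C \<inter> B) \<le> exp (4 * D) * weight ?V x * prob B"
    unfolding eq c[symmetric]
    by (intro integral_mono_AE int_g int_c eventually_mono[OF ae] mult_left_mono) auto
  show "exp (- 4 * D) * weight ?V x * prob B \<le> prob (?C \<inter> B)"
    unfolding eq c[symmetric]
    by (intro integral_mono_AE int_g int_c eventually_mono[OF ae] mult_left_mono) auto
qed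

lemma cylinder_bounds:
  assumes "a \<le> b"
  shows "prob (cylinder {a..b} x) \<le> exp (4 * D) * weight {a..b} x"
    and "exp (- 4 * D) * weight {a..b} x \<le> prob (cylinder {a..b} x)"
  using conditional_bounds[OF assms, of UNIV x] sets.top[of "sub_field (- {a..b})"] prob_space
  by auto

lemma match_sets: "match i j k \<in> sets P"
proof -
  have "{\<sigma>. \<sigma> a = \<sigma> b} \<in> sets P" for a b :: int
  proof -
    have "{\<sigma> :: int \<Rightarrow> 'a. \<sigma> a = \<sigma> b} = (\<Union>c\<in>UNIV. cylinder {a, b} (\<lambda>_. c))"
      by (auto simp: cylinder_def)
    moreover have "\<dots> \<in> sets P" by (intro sets.finite_UN cylinder_sets) auto
    ultimately show ?thesis by simp
  qed
  then have "{\<sigma>\<in>space P. \<forall>l\<in>block k. \<sigma> (i + l) = \<sigma> (j + l)} \<in> sets P"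
    by (intro sets.sets_Collect_finite_All) auto
  then show ?thesis by (simp add: match_def)
qed

section \<open>Match probabilities for disjoint and for overlapping windows\<close>

text \<open>The match is split by the word on the first window; the second window then carries its
  translate, of equal weight. Each window costs a factor \<open>exp (4 * D)\<close>, and the squared
  weights sum to the collision ratio.\<close>

lemma match_disjoint_bounds:
  assumes k: "1 \<le> k" and ij: "k \<le> j - i"
  shows "prob (match i j k) \<le> exp (8 * D) * collision k"
    and "exp (- 8 * D) * collision k \<le> prob (match i j k)"
proof -
  let ?I = "{i + 1..i + k}" and ?J = "{j + 1..j + k}" and ?s = "shift (- (j - i)) :: (int \<Rightarrow> 'a) \<Rightarrow> _"
  have "match i j k = (\<Union>\<eta>\<in>?I \<rightarrow>\<^sub>E UNIV. cylinder ?I \<eta> \<inter> cylinder ?J (?s \<eta>))" (is "_ = ?R")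
  proof (intro set_eqI iffI)
    fix \<sigma> :: "int \<Rightarrow> 'a" assume m: "\<sigma> \<in> match i j k"
    have "\<sigma> \<in> cylinder ?J (?s (restrict \<sigma> ?I))"
      unfolding cylinder_def
    proof (clarify)
      fix x assume x: "x \<in> ?J"
      then have "x - j \<in> block k" by auto
      with m have "\<sigma> (i + (x - j)) = \<sigma> (j + (x - j))" by (auto simp: match_def)
      then show "\<sigma> x = ?s (restrict \<sigma> ?I) x" using x by (simp add: shift_def algebra_simps)
    qed
    moreover have "\<sigma> \<in> cylinder ?I (restrict \<sigma> ?I)" by (auto simp: cylinder_def)
    moreover have "restrict \<sigma> ?I \<in> ?I \<rightarrow>\<^sub>E UNIV" by simp
    ultimately show "\<sigma> \<in> ?R" by blast
  next
    fix \<sigma> :: "int \<Rightarrow> 'a" assume "\<sigma> \<in> ?R"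
    then show "\<sigma> \<in> match i j k"
      by (auto simp: match_def cylinder_def shift_def)
  qed
  then have eq: "prob (match i j k) = (\<Sum>\<eta>\<in>?I \<rightarrow>\<^sub>E UNIV. prob (cylinder ?I \<eta> \<inter> cylinder ?J (?s \<eta>)))"
    by (simp add: finite_measure_finite_Union finite_configs disjoint_cylinders cylinder_sets
        sets.Int image_subset_iff)
  have w: "weight ?J (?s \<eta>) = weight ?I \<eta>" for \<eta>
    using weight_translate[of "i + 1" "j - i" "i + k" \<eta>] by (simp add: algebra_simps)
  have I: "i + 1 \<le> i + k" and J: "j + 1 \<le> j + k" using k by auto
  \<comment> \<open>Disjointness makes the second cylinder an event outside the first window, as
    conditioning requires.\<close>
  have "?J \<subseteq> - ?I" using ij by auto
  then have cyl: "cylinder ?J (?s \<eta>) \<in> sets (sub_field (- ?I))" for \<eta>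
    by (intro cylinder_in_sub_field) auto
  have e8: "exp (8 * D) = exp (4 * D) * exp (4 * D)" "exp (- 8 * D) = exp (- 4 * D) * exp (- 4 * D)"
    by (simp_all add: mult_exp_exp)
  have "prob (match i j k) \<le> (\<Sum>\<eta>\<in>?I \<rightarrow>\<^sub>E UNIV. exp (8 * D) * (weight ?I \<eta>)\<^sup>2)"
    unfolding eq
  proof (rule sum_mono)
    fix \<eta>
    have "prob (cylinder ?I \<eta> \<inter> cylinder ?J (?s \<eta>))
        \<le> exp (4 * D) * weight ?I \<eta> * prob (cylinder ?J (?s \<eta>))"
      by (rule conditional_bounds(1)[OF I cyl])
    also have "\<dots> \<le> exp (4 * D) * weight ?I \<eta> * (exp (4 * D) * weight ?J (?s \<eta>))"
      by (intro mult_left_mono cylinder_bounds(1)[OF J] mult_nonneg_nonneg weight_nonneg) auto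
    finally show "prob (cylinder ?I \<eta> \<inter> cylinder ?J (?s \<eta>)) \<le> exp (8 * D) * (weight ?I \<eta>)\<^sup>2"
      unfolding w e8 by (simp add: power2_eq_square mult.assoc mult.left_commute)
  qed
  then show "prob (match i j k) \<le> exp (8 * D) * collision k"
    by (simp only: sum_distrib_left[symmetric] sum_weight_square)
  have "(\<Sum>\<eta>\<in>?I \<rightarrow>\<^sub>E UNIV. exp (- 8 * D) * (weight ?I \<eta>)\<^sup>2) \<le> prob (match i j k)"
    unfolding eq
  proof (rule sum_mono)
    fix \<eta>
    have "exp (- 8 * D) * (weight ?I \<eta>)\<^sup>2 = exp (- 4 * D) * weight ?I \<eta> * (exp (- 4 * D) * weight ?J (?s \<eta>))"
      unfolding w e8 by (simp add: power2_eq_square mult.assoc mult.left_commute)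
    also have "\<dots> \<le> exp (- 4 * D) * weight ?I \<eta> * prob (cylinder ?J (?s \<eta>))"
      by (intro mult_left_mono cylinder_bounds(2)[OF J] mult_nonneg_nonneg weight_nonneg) auto
    also have "\<dots> \<le> prob (cylinder ?I \<eta> \<inter> cylinder ?J (?s \<eta>))"
      by (rule conditional_bounds(2)[OF I cyl])
    finally show "exp (- 8 * D) * (weight ?I \<eta>)\<^sup>2 \<le> prob (cylinder ?I \<eta> \<inter> cylinder ?J (?s \<eta>))" .
  qed
  then show "exp (- 8 * D) * collision k \<le> prob (match i j k)"
    by (simp only: sum_distrib_left[symmetric] sum_weight_square)
qed

text \<open>A match at offset \<open>m\<close> says that letters at distance \<open>m\<close> agree
  throughout the union of the windows; stepping back by \<open>m\<close> repeatedly leads into the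
  first \<open>m\<close> sites.\<close>

lemma match_periodic:
  assumes m: "1 \<le> m" and \<sigma>: "\<sigma> \<in> match i (i + m) k" and x: "i + 1 \<le> x" "x \<le> i + m + k"
  shows "\<sigma> x = \<sigma> (i + 1 + (x - i - 1) mod m)"
proof -
  have "\<sigma> (i + 1 + int n) = \<sigma> (i + 1 + int n mod m)" if "int n < m + k" for n
    using that
  proof (induction n rule: less_induct)
    case (less n)
    show ?case
    proof (cases "int n < m")
      case False
      define n' where "n' = n - nat m"
      have n': "int n' = int n - m" "n' < n" using False m by (auto simp: n'_def)
      have "int n' + 1 \<in> block k" using less.prems n' False by auto
      with \<sigma> have "\<sigma> (i + (int n' + 1)) = \<sigma> (i + m + (int n' + 1))" by (auto simp: match_def)
      moreover have "i + (int n' + 1) = i + 1 + int n'" "i + m + (int n' + 1) = i + 1 + int n"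
        using n' by simp_all
      ultimately have "\<sigma> (i + 1 + int n) = \<sigma> (i + 1 + int n')" by metis
      also have "\<dots> = \<sigma> (i + 1 + int n' mod m)" using less.IH[of n'] n' less.prems m by simp
      also have "int n' mod m = int n mod m" using n' by simp
      finally show ?thesis .
    qed simp
  qed
  from this[of "nat (x - i - 1)"] x show ?thesis by (simp add: algebra_simps)
qed

text \<open>By periodicity the first \<open>m\<close> letters determine all \<open>m + k\<close>.
  The first two stretches of length \<open>m\<close> carry the same word, which produces a collision
  ratio; the remaining \<open>k - m\<close> letters form one prescribed word, bounded uniformly by
  \<open>weight_le_sqrt_collision\<close>.\<close>

lemma match_overlap_bound:
  assumes m: "1 \<le> m" "m < k"
  shows "prob (match i (i + m) k) \<le> exp (12 * D) * (collision m * sqrt (collision (k - m)))"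
proof -
  let ?I = "{i + 1..i + m}" and ?J = "{i + m + 1..i + m + m}" and ?K = "{i + m + m + 1..i + m + m + (k - m)}"
  \<comment> \<open>\<open>g \<eta>\<close> is the \<open>m\<close>-periodic extension of the word
    \<open>\<eta>\<close>.\<close>
  define g :: "(int \<Rightarrow> 'a) \<Rightarrow> int \<Rightarrow> 'a" where "g \<eta> x = \<eta> (i + 1 + (x - i - 1) mod m)" for \<eta> x
  let ?E = "\<lambda>\<eta>. cylinder ?I \<eta> \<inter> (cylinder ?J (g \<eta>) \<inter> cylinder ?K (g \<eta>))"
  have "match i (i + m) k \<subseteq> (\<Union>\<eta>\<in>?I \<rightarrow>\<^sub>E UNIV. ?E \<eta>)"
  proof
    fix \<sigma> :: "int \<Rightarrow> 'a" assume \<sigma>: "\<sigma> \<in> match i (i + m) k"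
    have "\<sigma> x = g (restrict \<sigma> ?I) x" if "i + 1 \<le> x" "x \<le> i + m + k" for x
    proof -
      have "0 \<le> (x - i - 1) mod m" "(x - i - 1) mod m < m" using m by auto
      then have "i + 1 + (x - i - 1) mod m \<in> ?I" by auto
      then show ?thesis using match_periodic[OF m(1) \<sigma> that] by (simp add: g_def)
    qed
    then have "\<sigma> \<in> ?E (restrict \<sigma> ?I)" using m by (auto simp: cylinder_def)
    moreover have "restrict \<sigma> ?I \<in> ?I \<rightarrow>\<^sub>E UNIV" by simp
    ultimately show "\<sigma> \<in> (\<Union>\<eta>\<in>?I \<rightarrow>\<^sub>E UNIV. ?E \<eta>)" by blast
  qed
  moreover have E: "?E \<eta> \<in> sets P" for \<eta> by (intro sets.Int cylinder_sets) auto
  ultimately have "prob (match i (i + m) k) \<le> prob (\<Union>\<eta>\<in>?I \<rightarrow>\<^sub>E UNIV. ?E \<eta>)"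
    by (intro finite_measure_mono sets.finite_UN) (auto intro: finite_configs)
  also have "\<dots> \<le> (\<Sum>\<eta>\<in>?I \<rightarrow>\<^sub>E UNIV. prob (?E \<eta>))"
    using E by (intro finite_measure_subadditive_finite finite_configs) auto
  also have "\<dots> \<le> (\<Sum>\<eta>\<in>?I \<rightarrow>\<^sub>E UNIV. (exp (12 * D) * sqrt (collision (k - m))) * (weight ?I \<eta>)\<^sup>2)"
  proof (rule sum_mono)
    fix \<eta> :: "int \<Rightarrow> 'a"
    have nonneg: "0 \<le> exp (4 * D) * weight ?I \<eta>" by (intro mult_nonneg_nonneg weight_nonneg) auto
    \<comment> \<open>The three stretches are peeled off from left to right, each conditioned on
      those after it.\<close>
    have "cylinder ?J (g \<eta>) \<inter> cylinder ?K (g \<eta>) \<in> sets (sub_field (- ?I))"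
      using m by (intro sets.Int cylinder_in_sub_field) auto
    then have "prob (?E \<eta>) \<le> exp (4 * D) * weight ?I \<eta> * prob (cylinder ?J (g \<eta>) \<inter> cylinder ?K (g \<eta>))"
      using m by (intro conditional_bounds(1)) auto
    also have "\<dots> \<le> exp (4 * D) * weight ?I \<eta> * (exp (4 * D) * weight ?J (g \<eta>) * prob (cylinder ?K (g \<eta>)))"
      using m by (intro mult_left_mono[OF _ nonneg] conditional_bounds(1) cylinder_in_sub_field) auto
    also have "weight ?J (g \<eta>) = weight ?J (shift (- m) \<eta>)"
    proof (rule weight_cong)
      fix x assume "x \<in> ?J"
      then have x: "0 \<le> x - m - i - 1" "x - m - i - 1 < m" by auto
      have "(x - i - 1) mod m = (x - m - i - 1) mod m"
        using mod_add_self2[of "x - m - i - 1" m] by (simp add: algebra_simps)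
      also have "\<dots> = x - m - i - 1" using x by (rule mod_pos_pos_trivial)
      finally have "(x - i - 1) mod m = x - m - i - 1" .
      then show "g \<eta> x = shift (- m) \<eta> x" by (simp add: g_def shift_def)
    qed
    also have "\<dots> = weight ?I \<eta>"
      using weight_translate[of "i + 1" m "i + m" \<eta>] by (simp add: algebra_simps)
    also have "exp (4 * D) * weight ?I \<eta> * (exp (4 * D) * weight ?I \<eta> * prob (cylinder ?K (g \<eta>)))
        \<le> exp (4 * D) * weight ?I \<eta> * (exp (4 * D) * weight ?I \<eta> * (exp (4 * D) * sqrt (collision (k - m))))"
    proof (intro mult_left_mono[OF _ nonneg])
      have "prob (cylinder ?K (g \<eta>)) \<le> exp (4 * D) * weight ?K (g \<eta>)"
        using m by (intro cylinder_bounds) auto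
      also have "\<dots> \<le> exp (4 * D) * sqrt (collision (k - m))"
        by (intro mult_left_mono weight_le_sqrt_collision) auto
      finally show "prob (cylinder ?K (g \<eta>)) \<le> exp (4 * D) * sqrt (collision (k - m))" .
    qed
    also have "\<dots> = (exp (4 * D) * exp (4 * D) * exp (4 * D) * sqrt (collision (k - m))) * (weight ?I \<eta>)\<^sup>2"
      by (simp add: power2_eq_square mult_ac)
    also have "exp (4 * D) * exp (4 * D) * exp (4 * D) = exp (12 * D)"
      by (simp add: mult_exp_exp)
    finally show "prob (?E \<eta>) \<le> (exp (12 * D) * sqrt (collision (k - m))) * (weight ?I \<eta>)\<^sup>2" .
  qed
  also have "\<dots> = exp (12 * D) * (collision m * sqrt (collision (k - m)))"
    by (simp only: sum_distrib_left[symmetric] sum_weight_square mult_ac)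
  finally show ?thesis .
qed

text \<open>The first summand covers disjoint windows, the second overlapping ones; adding them
  gives one bound for all offsets.\<close>

lemma match_upper_less:
  assumes k: "1 \<le> k" and ij: "i < j"
  shows "prob (match i j k)
    \<le> exp (18 * D) * (exp (- 2 * alpha U * k) + exp (- alpha U * k) * exp (- alpha U * \<bar>j - i\<bar>))"
proof (cases "k \<le> j - i")
  case True
  have "prob (match i j k) \<le> exp (8 * D) * (exp (4 * D) * exp (- 2 * alpha U * k))"
    by (rule order.trans[OF match_disjoint_bounds(1)[OF k True]]) (intro mult_left_mono collision_bounds k; simp)
  also have "\<dots> = exp (12 * D) * exp (- 2 * alpha U * k)" by (simp add: mult_exp_exp)
  also have "\<dots> \<le> exp (18 * D) * exp (- 2 * alpha U * k)" using D_nonneg by (intro mult_right_mono) auto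
  finally show ?thesis by (simp add: distrib_left add_increasing2)
next
  case False
  define m where "m = j - i"
  have m: "1 \<le> m" "m < k" "j = i + m" using False ij by (auto simp: m_def)
  have "prob (match i j k) \<le> exp (12 * D) * (collision m * sqrt (collision (k - m)))"
    unfolding m(3) by (rule match_overlap_bound[OF m(1,2)])
  \<comment> \<open>The square root halves both the rate and the error exponent
    \<open>4 * D\<close>, whence 12 + 4 + 2 = 18. The rates add up to 2m + (k - m) = k + m.\<close>
  also have "\<dots> \<le> exp (12 * D) * ((exp (4 * D) * exp (- 2 * alpha U * m)) * (exp (2 * D) * exp (- alpha U * (k - m))))"
  proof (intro mult_left_mono mult_mono collision_bounds m)
    have "sqrt (collision (k - m)) \<le> sqrt (exp (4 * D) * exp (- 2 * alpha U * (k - m)))"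
      using collision_bounds(1)[of "k - m"] m by simp
    also have "exp (4 * D) * exp (- 2 * alpha U * (k - m)) = (exp (2 * D) * exp (- alpha U * (k - m)))\<^sup>2"
      by (simp add: power2_eq_square mult_exp_exp algebra_simps)
    finally show "sqrt (collision (k - m)) \<le> exp (2 * D) * exp (- alpha U * (k - m))" by simp
  qed (auto simp: less_imp_le collision_pos)
  also have "\<dots> = exp (18 * D) * (exp (- alpha U * k) * exp (- alpha U * \<bar>j - i\<bar>))"
    using m by (simp add: mult_exp_exp algebra_simps)
  also have "\<dots> \<le> exp (18 * D) * (exp (- 2 * alpha U * k) + exp (- alpha U * k) * exp (- alpha U * \<bar>j - i\<bar>))"
    by (intro mult_left_mono) auto
  finally show ?thesis .
qed

lemma match_upper:
  assumes "1 \<le> k" "i \<noteq> j"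
  shows "prob (match i j k)
    \<le> exp (18 * D) * (exp (- 2 * alpha U * k) + exp (- alpha U * k) * exp (- alpha U * \<bar>j - i\<bar>))"
  using match_upper_less[of k i j] match_upper_less[of k j i] assms
  by (cases "i < j") (auto simp: match_sym[of j i] abs_minus_commute)

text \<open>The constant 12 is 8 from the two windows plus 4 from the collision ratio.\<close>

lemma match_lower:
  assumes "1 \<le> k" "k \<le> \<bar>j - i\<bar>"
  shows "exp (- 12 * D) * exp (- 2 * alpha U * k) \<le> prob (match i j k)"
proof -
  have "exp (- 12 * D) * exp (- 2 * alpha U * k) = exp (- 8 * D) * (exp (- 4 * D) * exp (- 2 * alpha U * k))"
    by (simp add: mult_exp_exp)
  also have "\<dots> \<le> exp (- 8 * D) * collision k"
    by (intro mult_left_mono collision_bounds assms) auto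
  also have "\<dots> \<le> prob (match i j k)"
    using match_disjoint_bounds(2)[of k j i] match_disjoint_bounds(2)[of k i j] assms
    by (cases "i < j") (auto simp: match_sym[of j i])
  finally show ?thesis .
qed

end

section \<open>The expected number of matches\<close>

lemma shift_matches_eq_sum_match:
  "shift_matches \<sigma> n k
    = 1 / 2 * (\<Sum>i\<in>{0..n - k}. \<Sum>j\<in>{0..n - k} - {i}. indicator (match i j k) \<sigma>)"
proof -
  have "restrict (shift i \<sigma>) (block k) = restrict (shift j \<sigma>) (block k) \<longleftrightarrow> \<sigma> \<in> match i j k" for i j
    unfolding match_def by (auto simp: fun_eq_iff shift_def restrict_def)
  then show ?thesis by (simp add: shift_matches_def indicator_def of_bool_def)
qed

text \<open>Ensures that lengths exceeding \<open>kstar\<close> by at most a constant eventually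
  satisfy \<open>6 * k \<le> n\<close>; each of the two summands is allotted
  \<open>n / 12\<close>.\<close>

lemma eventually_ln_div_le:
  fixes a M :: real
  assumes "0 < a"
  shows "\<forall>\<^sub>F n in sequentially. ln (real n) / a + M \<le> real n / 6"
proof -
  have "\<forall>\<^sub>F n in sequentially. ln (real n) / real n < a / 12"
    using lim_ln_over_n assms by (intro order_tendstoD(2)[of _ 0]) auto
  moreover have "\<forall>\<^sub>F n in sequentially. 12 * M \<le> real n"
    by (rule eventually_ge_at_top[THEN eventually_compose_filterlim[OF _ filterlim_real_sequentially]])
  moreover have "\<forall>\<^sub>F n in sequentially. 1 \<le> n" by (rule eventually_ge_at_top)
  ultimately show ?thesis
  proof eventually_elim
    case (elim n)
    then have "ln (real n) / a \<le> real n / 12" using assms by (simp add: field_simps)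
    with elim show ?case by linarith
  qed
qed

context gibbs_system
begin

abbreviation expected_matches :: "int \<Rightarrow> int \<Rightarrow> real" where
  "expected_matches n k \<equiv> \<integral>\<sigma>. shift_matches \<sigma> n k \<partial>P"

lemma expected_matches_eq:
  "expected_matches n k = 1 / 2 * (\<Sum>i\<in>{0..n - k}. \<Sum>j\<in>{0..n - k} - {i}. prob (match i j k))"
proof -
  have int: "integrable P (indicator (match i j k) :: _ \<Rightarrow> real)" for i j
    using match_sets by (intro integrable_real_indicator) (simp_all add: emeasure_eq_measure)
  show ?thesis unfolding shift_matches_eq_sum_match by (simp add: int)
qed

text \<open>For fixed \<open>i\<close>, the disjoint-window terms sum to at most n e^(-2 \<alpha>
  k), and the overlap terms form a geometric series of size e^(-\<alpha> k). Summing over at most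
  \<open>n\<close> values of \<open>i\<close> gives t^2 and t respectively.\<close>

lemma expected_matches_upper:
  assumes a: "0 < alpha U" and k: "1 \<le> k" "k \<le> n"
  defines "t \<equiv> real_of_int n * exp (- alpha U * k)"
  shows "expected_matches n k \<le> exp (18 * D) * (1 + 2 / (1 - exp (- alpha U))) * (t\<^sup>2 + t)"
proof -
  let ?J = "{0..n - k}" and ?G = "2 / (1 - exp (- alpha U))" and ?C = "exp (18 * D)"
  let ?e = "exp (- alpha U * k)"
  have G: "0 \<le> ?G" using a by simp
  have e2: "exp (- 2 * alpha U * k) = ?e\<^sup>2" by (simp add: power2_eq_square mult_exp_exp)
  have n: "0 \<le> real_of_int n" using k by simp
  have t: "0 \<le> t" using n by (simp add: t_def)
  have card: "real (card ?J) \<le> n" "real (card (?J - {i})) \<le> n" for i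
    using k card_mono[of ?J "?J - {i}"] by auto
  have inner: "(\<Sum>j\<in>?J - {i}. prob (match i j k)) \<le> ?C * (n * ?e\<^sup>2 + ?e * ?G)" for i
  proof -
    have "(\<Sum>j\<in>?J - {i}. prob (match i j k))
        \<le> (\<Sum>j\<in>?J - {i}. ?C * (?e\<^sup>2 + ?e * exp (- alpha U * \<bar>j - i\<bar>)))"
    proof (rule sum_mono)
      fix j assume "j \<in> ?J - {i}"
      then have "i \<noteq> j" by auto
      from match_upper[OF k(1) this]
      show "prob (match i j k) \<le> ?C * (?e\<^sup>2 + ?e * exp (- alpha U * \<bar>j - i\<bar>))" by (simp only: e2)
    qed
    also have "\<dots> = ?C * (card (?J - {i}) * ?e\<^sup>2 + ?e * (\<Sum>j\<in>?J - {i}. exp (- alpha U * \<bar>j - i\<bar>)))"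
      by (simp add: sum_distrib_left[symmetric] sum.distrib)
    also have "\<dots> \<le> ?C * (n * ?e\<^sup>2 + ?e * ?G)"
      using a by (intro mult_left_mono add_mono mult_right_mono card sum_exp_abs_le) auto
    finally show ?thesis .
  qed
  have "expected_matches n k \<le> 1 / 2 * (\<Sum>i\<in>?J. ?C * (n * ?e\<^sup>2 + ?e * ?G))"
    unfolding expected_matches_eq by (intro mult_left_mono sum_mono inner) auto
  also have "\<dots> \<le> (\<Sum>i\<in>?J. ?C * (n * ?e\<^sup>2 + ?e * ?G))"
    using n G by (simp add: add_nonneg_nonneg)
  also have "\<dots> = card ?J * (?C * (n * ?e\<^sup>2 + ?e * ?G))" by simp
  also have "\<dots> \<le> n * (?C * (n * ?e\<^sup>2 + ?e * ?G))"
    using n G by (intro mult_right_mono card) (simp add: add_nonneg_nonneg)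
  also have "\<dots> = ?C * (t\<^sup>2 + ?G * t)" by (simp add: t_def power2_eq_square algebra_simps)
  also have "\<dots> \<le> ?C * ((1 + ?G) * (t\<^sup>2 + t))"
    using t G by (intro mult_left_mono) (auto simp: distrib_left distrib_right)
  finally show ?thesis by (simp add: mult.assoc)
qed

text \<open>Only disjoint windows are kept. There are at least n/2 choices of \<open>i\<close> and,
  for each, at least n/2 of \<open>j\<close>; with the factor 1/2 this yields the 8.\<close>

lemma expected_matches_lower:
  assumes k: "1 \<le> k" "6 * k \<le> n"
  defines "t \<equiv> real_of_int n * exp (- alpha U * k)"
  shows "exp (- 12 * D) / 8 * t\<^sup>2 \<le> expected_matches n k"
proof -
  let ?J = "{0..n - k}" and ?c = "exp (- 12 * D)" and ?e = "exp (- alpha U * k)"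
  have e2: "exp (- 2 * alpha U * k) = ?e\<^sup>2" by (simp add: power2_eq_square mult_exp_exp)
  have n: "0 \<le> real_of_int n" using k by simp
  have inner: "n / 2 * (?c * ?e\<^sup>2) \<le> (\<Sum>j\<in>?J - {i}. prob (match i j k))" for i
  proof -
    let ?F = "?J - {i - k + 1..i + k - 1}"
    \<comment> \<open>At most 2k - 1 of the n - k + 1 positions are excluded, leaving at least n -
      3k + 2, which exceeds n/2 because \<open>6 * k \<le> n\<close>.\<close>
    have "card ?J - card {i - k + 1..i + k - 1} \<le> card ?F"
      by (rule diff_card_le_card_Diff) simp
    then have "n / 2 \<le> real (card ?F)" using k by (simp add: nat_le_iff)
    then have "n / 2 * (?c * ?e\<^sup>2) \<le> real (card ?F) * (?c * ?e\<^sup>2)"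
      by (intro mult_right_mono) auto
    also have "\<dots> = (\<Sum>j\<in>?F. ?c * ?e\<^sup>2)" by simp
    also have "\<dots> \<le> (\<Sum>j\<in>?F. prob (match i j k))"
    proof (rule sum_mono)
      fix j assume "j \<in> ?F"
      then have "k \<le> \<bar>j - i\<bar>" by auto
      from match_lower[OF k(1) this] show "?c * ?e\<^sup>2 \<le> prob (match i j k)" by (simp only: e2)
    qed
    also have "\<dots> \<le> (\<Sum>j\<in>?J - {i}. prob (match i j k))"
      using k by (intro sum_mono2) auto
    finally show ?thesis .
  qed
  have "n / 2 \<le> real (card ?J)" using k by simp
  then have "n / 2 * (n / 2 * (?c * ?e\<^sup>2)) \<le> card ?J * (n / 2 * (?c * ?e\<^sup>2))"
    using n by (intro mult_right_mono) auto
  also have "\<dots> = (\<Sum>i\<in>?J. n / 2 * (?c * ?e\<^sup>2))" by simp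
  also have "\<dots> \<le> (\<Sum>i\<in>?J. \<Sum>j\<in>?J - {i}. prob (match i j k))"
    by (intro sum_mono inner)
  also have "\<dots> = 2 * expected_matches n k" by (simp add: expected_matches_eq)
  finally show ?thesis by (simp add: t_def power2_eq_square algebra_simps)
qed

end

theorem theorem3p1:
  fixes U :: "('a::finite) interaction"
    and P :: "(int \<Rightarrow> 'a) measure"
    and k :: "nat \<Rightarrow> int"
  assumes "CARD('a) \<ge> 2"
    and "U \<in> interactions"
    and "gibbs_measure U P"
    and "\<forall>\<^sub>F n in sequentially. 1 \<le> k n \<and> k n \<le> int n"
  shows "alpha U > 0 \<and>
    (filterlim (\<lambda>n. kstar U n - real_of_int (k n)) at_top sequentially \<longrightarrow>
       filterlim (\<lambda>n. \<integral>\<sigma>. shift_matches \<sigma> (int n) (k n) \<partial>P) at_top sequentially) \<and>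
    (filterlim (\<lambda>n. real_of_int (k n) - kstar U n) at_top sequentially \<longrightarrow>
       (\<lambda>n. \<integral>\<sigma>. shift_matches \<sigma> (int n) (k n) \<partial>P) \<longlonglongrightarrow> 0) \<and>
    (bounded (range (\<lambda>n. real_of_int (k n) - kstar U n)) \<longrightarrow>
       0 < liminf (\<lambda>n. ereal (\<integral>\<sigma>. shift_matches \<sigma> (int n) (k n) \<partial>P)) \<and>
       liminf (\<lambda>n. ereal (\<integral>\<sigma>. shift_matches \<sigma> (int n) (k n) \<partial>P))
         \<le> limsup (\<lambda>n. ereal (\<integral>\<sigma>. shift_matches \<sigma> (int n) (k n) \<partial>P)) \<and>
       limsup (\<lambda>n. ereal (\<integral>\<sigma>. shift_matches \<sigma> (int n) (k n) \<partial>P)) < \<infinity>)"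
proof -
  obtain N S D where "bounded_interaction U N S D"
    using bounded_interaction_exists[OF assms(2)] by blast
  then interpret gibbs_system U N S D P
    by (intro gibbs_system.intro gibbs_system_axioms.intro assms(3))
  have a: "0 < alpha U" by (rule alpha_pos[OF assms(1)])
  define t where "t n = exp (alpha U * (kstar U n - k n))" for n
  define E where "E n = expected_matches (int n) (k n)" for n
  define C where "C = exp (18 * D) * (1 + 2 / (1 - exp (- alpha U)))"
  define c where "c = exp (- 12 * D) / 8"
  have c: "0 < c" by (simp add: c_def)
  have t_eq: "t n = real n * exp (- alpha U * k n)" if "1 \<le> n" for n
  proof -
    have "alpha U * (kstar U n - k n) = ln (real n) + - alpha U * k n"
      using a by (simp add: kstar_def field_simps)
    then show ?thesis using that by (simp add: t_def exp_add exp_diff exp_minus divide_inverse)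
  qed
  have E_nonneg: "0 \<le> E n" for n
    by (simp add: E_def expected_matches_eq sum_nonneg)
  have ev1: "\<forall>\<^sub>F n in sequentially. 1 \<le> n" by (rule eventually_ge_at_top)
  have upper: "\<forall>\<^sub>F n in sequentially. E n \<le> C * ((t n)\<^sup>2 + t n)"
    using ev1 assms(4)
  proof eventually_elim
    case (elim n)
    then show ?case using expected_matches_upper[OF a, of "k n" "int n"] by (simp add: E_def C_def t_eq)
  qed
  \<comment> \<open>The upper bound on \<open>k n\<close> guarantees \<open>6 * k n \<le> n\<close>
    eventually. It holds with \<open>M = 0\<close> in the first regime and with the bound of the
    sequence in the third.\<close>
  have lower: "\<forall>\<^sub>F n in sequentially. c * (t n)\<^sup>2 \<le> E n"
    if "\<forall>\<^sub>F n in sequentially. k n \<le> kstar U n + M" for M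
    using ev1 assms(4) that eventually_ln_div_le[OF a, of M]
  proof eventually_elim
    case (elim n)
    then have "6 * real_of_int (k n) \<le> real n" unfolding kstar_def by linarith
    then have "6 * k n \<le> int n" by linarith
    with elim show ?case using expected_matches_lower[of "k n" "int n"] by (simp add: E_def c_def t_eq)
  qed
  have case1: "filterlim E at_top sequentially"
    if "filterlim (\<lambda>n. kstar U n - real_of_int (k n)) at_top sequentially"
  proof (rule filterlim_at_top_mono)
    have "\<forall>\<^sub>F n in sequentially. 0 \<le> kstar U n - k n"
      using that by (simp only: filterlim_at_top)
    then show "\<forall>\<^sub>F n in sequentially. c * (t n)\<^sup>2 \<le> E n"
      by (intro lower[of 0]) (auto elim: eventually_mono)
    have "filterlim t at_top sequentially"
      unfolding t_def using a
      by (intro filterlim_compose[OF exp_at_top] filterlim_tendsto_pos_mult_at_top[OF tendsto_const _ that])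
    then show "filterlim (\<lambda>n. c * (t n)\<^sup>2) at_top sequentially"
      using c by (intro filterlim_tendsto_pos_mult_at_top[OF tendsto_const] filterlim_pow_at_top) auto
  qed
  have case2: "E \<longlonglongrightarrow> 0"
    if "filterlim (\<lambda>n. real_of_int (k n) - kstar U n) at_top sequentially"
  proof (rule tendsto_sandwich[of "\<lambda>_. 0"])
    have "filterlim (\<lambda>n. alpha U * (k n - kstar U n)) at_top sequentially"
      using a by (intro filterlim_tendsto_pos_mult_at_top[OF tendsto_const _ that])
    then have "filterlim (\<lambda>n. - (alpha U * (k n - kstar U n))) at_bot sequentially"
      by (simp add: filterlim_uminus_at_top)
    then have "filterlim (\<lambda>n. alpha U * (kstar U n - k n)) at_bot sequentially"
      by (simp add: algebra_simps)
    then have "t \<longlonglongrightarrow> 0"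
      unfolding t_def by (rule filterlim_compose[OF exp_at_bot])
    then have "(\<lambda>n. C * ((t n)\<^sup>2 + t n)) \<longlonglongrightarrow> C * (0\<^sup>2 + 0)"
      by (intro tendsto_intros)
    then show "(\<lambda>n. C * ((t n)\<^sup>2 + t n)) \<longlonglongrightarrow> 0" by simp
  qed (use upper E_nonneg in auto)
  have case3: "0 < liminf (\<lambda>n. ereal (E n)) \<and> limsup (\<lambda>n. ereal (E n)) < \<infinity>"
    if bdd: "bounded (range (\<lambda>n. real_of_int (k n) - kstar U n))"
  proof -
    obtain M where M: "\<bar>k n - kstar U n\<bar> \<le> M" for n
      using bdd by (auto simp: bounded_iff)
    \<comment> \<open>Boundedness of \<open>k n - kstar U n\<close> confines \<open>t n\<close> to a
      compact interval of positive reals, so both quadratic estimates become constants.\<close>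
    have "- (alpha U * M) \<le> alpha U * (kstar U n - k n)" "alpha U * (kstar U n - k n) \<le> alpha U * M" for n
      using mult_left_mono[of "kstar U n - k n" M "alpha U"] mult_left_mono[of "- M" "kstar U n - k n" "alpha U"]
        M[of n] a by (auto simp: abs_le_iff)
    then have t: "exp (- (alpha U * M)) \<le> t n" "t n \<le> exp (alpha U * M)" for n
      by (simp_all add: t_def)
    have "\<forall>\<^sub>F n in sequentially. k n \<le> kstar U n + M"
      using M by (intro always_eventually allI) (simp add: abs_le_iff algebra_simps)
    from lower[OF this] have "\<forall>\<^sub>F n in sequentially. ereal (c * (exp (- (alpha U * M)))\<^sup>2) \<le> ereal (E n)"
    proof eventually_elim
      case (elim n)
      have "c * (exp (- (alpha U * M)))\<^sup>2 \<le> c * (t n)\<^sup>2"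
        using c t by (intro mult_left_mono power_mono) auto
      with elim show ?case by simp
    qed
    then have "ereal (c * (exp (- (alpha U * M)))\<^sup>2) \<le> liminf (\<lambda>n. ereal (E n))"
      by (rule Liminf_bounded)
    then have "0 < liminf (\<lambda>n. ereal (E n))"
      by (rule order.strict_trans2[rotated]) (use c in simp)
    moreover have "\<forall>\<^sub>F n in sequentially. ereal (E n) \<le> ereal (C * ((exp (alpha U * M))\<^sup>2 + exp (alpha U * M)))"
      using upper
    proof eventually_elim
      case (elim n)
      have "0 \<le> C" using a by (simp add: C_def)
      moreover have "0 \<le> t n" by (simp add: t_def)
      ultimately have "C * ((t n)\<^sup>2 + t n) \<le> C * ((exp (alpha U * M))\<^sup>2 + exp (alpha U * M))"
        using t by (intro mult_left_mono add_mono power_mono) auto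
      with elim show ?case by simp
    qed
    then have "limsup (\<lambda>n. ereal (E n)) \<le> ereal (C * ((exp (alpha U * M))\<^sup>2 + exp (alpha U * M)))"
      by (rule Limsup_bounded)
    then have "limsup (\<lambda>n. ereal (E n)) < \<infinity>"
      by (rule order.strict_trans1) simp
    ultimately show ?thesis ..
  qed
  have "liminf (\<lambda>n. ereal (E n)) \<le> limsup (\<lambda>n. ereal (E n))"
    by (intro Liminf_le_Limsup) simp
  with a case1 case2 case3 show ?thesis unfolding E_def by blast
qed

end
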